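(* There exists an absolute constant $M>0$ such that whenever $p$ is a prime, $G$ is a proper multiplicative subgroup of $\mathbb{F}_p^*$ with $|G|>M$, and $\lambda\in\mathbb{F}_p^*$, there are no sets $A,B,C\subset\mathbb{F}_p^*$ with $|A|,|B|,|C|\ge 2$ such that $ABC=(G-\lambda)\setminus\{0\}$.
   Context: $ABC=\{abc:a\in A,b\in B,c\in C\}$ and $G-\lambda=\{g-\lambda:g\in G\}$. *)

theory Defs
  imports Complex_Main "HOL-Number_Theory.Residues"
begin

text \<open>
  The prime \<open>p\<close> is quantified inside the statement, after the absolute constant, so
  \<open>\<bbbF>\<^sub>p\<close> is the ring object \<^term>\<open>residue_ring (int p)\<close> and not a type.
\<close>

abbreviation Fp :: "nat \<Rightarrow> int ring" where
  "Fp p \<equiv> residue_ring (int p)"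

abbreviation Fp_star :: "nat \<Rightarrow> int monoid" where
  "Fp_star p \<equiv> mult_of (Fp p)"

definition prod_set3 :: "nat \<Rightarrow> int set \<Rightarrow> int set \<Rightarrow> int set \<Rightarrow> int set" where
  "prod_set3 p A B C =
     {a \<otimes>\<^bsub>Fp p\<^esub> b \<otimes>\<^bsub>Fp p\<^esub> c | a b c. a \<in> A \<and> b \<in> B \<and> c \<in> C}"

definition shift_set :: "nat \<Rightarrow> int set \<Rightarrow> int \<Rightarrow> int set" where
  "shift_set p G l = {g \<ominus>\<^bsub>Fp p\<^esub> l | g. g \<in> G}"

end

theory Submission
  imports Defs "HOL-Computational_Algebra.Computational_Algebra" "HOL-Library.Product_Lexorder"
begin

text \<open>
  Write \<open>D = |G|\<close> and \<open>S = (G - \<lambda>) \<setminus> {0} = ABC\<close>. For every \<open>x \<in> BC\<close> the functions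
  \<open>(x + \<lambda>/a)\<^sup>D\<close> with \<open>a \<in> A\<close> take values independent of \<open>x\<close>. Stepanov's method applied to
  combinations, with coefficients of small degree, of products of at most two of these functions
  bounds \<open>|BC|\<close> by about \<open>4D/n\<^sup>2\<close> for any \<open>n\<close> elements of \<open>A\<close>, as long as \<open>n\<^sup>5\<close> is small compared
  with \<open>D\<close>. Together with \<open>|A| |BC| \<ge> |S|\<close> this rules out small \<open>A\<close> and otherwise yields
  \<open>|BC| = O(D\<^bsup>3/5\<^esup>)\<close>, and likewise for \<open>AC\<close> and \<open>AB\<close>; this contradicts
  \<open>|ABC|\<^sup>2 \<le> |AB| |BC| |CA|\<close>.

  If \<open>G\<close> has index two, squares of these functions are not available and \<open>|A| \<in> {2, 3}\<close> needs a
  separate argument: with the additional function \<open>x\<^sup>p\<close> the same method shows that all sign patterns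
  of \<open>x \<mapsto> (wx + \<lambda>)\<^sup>D\<close>, for \<open>w\<close> in the quotient set of \<open>A\<close>, are almost equally frequent, so some
  element of \<open>S\<close> is missed by \<open>A \<cdot> BC\<close>.

  Since \<open>p\<close> is not fixed by a type, polynomials over \<open>\<bbbF>\<^sub>p\<close> are represented by integer polynomials,
  and being zero modulo \<open>p\<close> means being divisible by the constant polynomial \<open>p\<close>.
\<close>

hide_const (open) UnivPoly.coeff UnivPoly.monom

section \<open>Linear algebra and polynomials modulo a prime\<close>

text \<open>A homogeneous linear system over F_p with more unknowns than equations has a nontrivial
  solution: two of the \<open>p ^ card U\<close> reduced assignments give the same residues, and
  their difference solves the system. Linearity enters only through differences.\<close>

lemma pigeonhole_mod:
  fixes p :: nat and T :: "('u \<Rightarrow> int) \<Rightarrow> 'c \<Rightarrow> int"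
  assumes p: "p \<ge> 2" and U: "finite U" and C: "finite C" and lt: "card C < card U"
    and diff: "\<And>x y c. c \<in> C \<Longrightarrow> T (\<lambda>j. x j - y j) c = T x c - T y c"
  shows "\<exists>x. (\<exists>j\<in>U. \<not> int p dvd x j) \<and> (\<forall>c\<in>C. int p dvd T x c)"
proof -
  let ?D = "U \<rightarrow>\<^sub>E {0..<int p}" and ?R = "C \<rightarrow>\<^sub>E {0..<int p}"
  let ?f = "\<lambda>x. restrict (\<lambda>c. T x c mod int p) C"
  have "card ?D = p ^ card U" "card ?R = p ^ card C"
    using U C by (simp_all add: card_PiE)
  moreover have "p ^ card C < p ^ card U" using lt p by simp
  moreover have "?f ` ?D \<subseteq> ?R" using p by auto
  moreover have "finite ?R" using C by (intro finite_PiE) auto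
  ultimately have "\<not> inj_on ?f ?D"
    by (metis card_inj_on_le leD)
  then obtain x y where xy: "x \<in> ?D" "y \<in> ?D" "x \<noteq> y" "?f x = ?f y"
    unfolding inj_on_def by blast
  then obtain j where j: "j \<in> U" "x j \<noteq> y j"
    by (meson PiE_ext)
  have "x j \<in> {0..<int p}" "y j \<in> {0..<int p}" using xy j by auto
  with j have "\<not> int p dvd x j - y j"
    by (metis atLeastLessThan_iff mod_eq_dvd_iff mod_pos_pos_trivial)
  moreover have "int p dvd T (\<lambda>j. x j - y j) c" if "c \<in> C" for c
  proof -
    have "T x c mod int p = T y c mod int p"
      using fun_cong[OF xy(4), of c] that by simp
    then show ?thesis using diff[OF that] by (simp add: mod_eq_dvd_iff)
  qed
  ultimately show ?thesis using j by (intro exI[of _ "\<lambda>j. x j - y j"]) blast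
qed

text \<open>For prime \<open>P\<close> this is linear independence of the rows
  \<open>v 0, ..., v (t - 1)\<close> over the quotient domain by \<open>P\<close>, phrased through
  divisibility so that neither quotient ring nor fraction field has to be formed.\<close>

definition indep_mod :: "'a::comm_ring_1 \<Rightarrow> nat \<Rightarrow> 'i set \<Rightarrow> (nat \<Rightarrow> 'i \<Rightarrow> 'a) \<Rightarrow> bool" where
  "indep_mod P t I v \<longleftrightarrow>
     (\<forall>c. (\<forall>i\<in>I. P dvd (\<Sum>k<t. c k * v k i)) \<longrightarrow> (\<forall>k<t. P dvd c k))"

text \<open>Row rank equals column rank. Gaussian elimination with a pivot in the last row removes
  one row and one column, and the induction hypothesis applies to the remaining minors.\<close>

lemma indep_mod_column_subset:
  fixes P :: "'a::idom"
  assumes P: "prime_elem P" and I: "finite I" and ind: "indep_mod P t I v"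
  shows "\<exists>J\<subseteq>I. card J = t \<and> indep_mod P t J v"
  using I ind
proof (induction t arbitrary: I v)
  case 0
  then show ?case by (intro exI[of _ "{}"]) (auto simp: indep_mod_def)
next
  case (Suc t)
  have "\<not> P dvd (1::'a)" using P by (simp add: prime_elem_def)
  have "\<exists>j\<in>I. \<not> P dvd v t j"
  proof (rule ccontr)
    assume "\<not> ?thesis"
    then have "\<forall>i\<in>I. P dvd (\<Sum>k<Suc t. (if k = t then 1 else 0) * v k i)"
      by (simp add: if_distrib[of "\<lambda>x. x * _"] cong: if_cong)
    with Suc.prems(2)[unfolded indep_mod_def, rule_format, of "\<lambda>k. if k = t then 1 else 0" t]
    have "P dvd 1" by simp
    with \<open>\<not> P dvd 1\<close> show False by simp
  qed
  then obtain j where j: "j \<in> I" "\<not> P dvd v t j" by blast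
  \<comment> \<open>Fraction-free elimination: the 2x2 minors with pivot \<open>v t j\<close> clear
    column \<open>j\<close> without division.\<close>
  define v' where "v' k i = v t j * v k i - v k j * v t i" for k i
  have key: "(\<Sum>k<t. c k * v' k i) = v t j * (\<Sum>k<Suc t. c k * v k i) - (\<Sum>k<Suc t. c k * v k j) * v t i"
    for c i
    by (simp add: v'_def algebra_simps sum_distrib_left sum_distrib_right sum_subtractf)
  have "indep_mod P t (I - {j}) v'"
    unfolding indep_mod_def
  proof (intro allI impI)
    fix c k assume c: "\<forall>i\<in>I - {j}. P dvd (\<Sum>k<t. c k * v' k i)" and k: "k < t"
    \<comment> \<open>The last coefficient is chosen so that the combination of the original rows
      vanishes in column \<open>j\<close>; in the other columns it reproduces the combination of the
      minors.\<close>
    define c' where "c' k = (if k < t then v t j * c k else - (\<Sum>k<t. c k * v k j))" for k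
    have "(\<Sum>k<Suc t. c' k * v k i) = (\<Sum>k<t. c k * v' k i)" for i
      by (simp add: c'_def v'_def algebra_simps sum_distrib_left sum_distrib_right sum_subtractf)
    moreover have "(\<Sum>k<t. c k * v' k j) = 0" by (simp add: v'_def)
    ultimately have "\<forall>i\<in>I. P dvd (\<Sum>k<Suc t. c' k * v k i)"
      using c by (metis Diff_iff dvd_0_right empty_iff insert_iff)
    then have "P dvd c' k" using Suc.prems(2) k unfolding indep_mod_def by (meson less_Suc_eq)
    then show "P dvd c k" using j(2) k P by (simp add: c'_def prime_elem_dvd_mult_iff)
  qed
  with Suc.IH[of "I - {j}" v'] Suc.prems(1) obtain J where J: "J \<subseteq> I - {j}" "card J = t" "indep_mod P t J v'"
    by auto
  have "indep_mod P (Suc t) (insert j J) v"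
    unfolding indep_mod_def
  proof (rule allI, rule impI)
    fix c assume c: "\<forall>i\<in>insert j J. P dvd (\<Sum>k<Suc t. c k * v k i)"
    then have "\<forall>i\<in>J. P dvd (\<Sum>k<t. c k * v' k i)"
      unfolding key by (auto intro!: dvd_diff dvd_mult dvd_mult2)
    with J(3) have a: "\<forall>k<t. P dvd c k" unfolding indep_mod_def by blast
    then have "P dvd (\<Sum>k<t. c k * v k j)" by (auto intro!: dvd_sum dvd_mult2)
    moreover have "P dvd (\<Sum>k<t. c k * v k j) + c t * v t j" using c by simp
    ultimately have "P dvd c t * v t j" by (metis dvd_add_right_iff)
    with j(2) P have "P dvd c t" by (simp add: prime_elem_dvd_mult_iff)
    with a show "\<forall>k<Suc t. P dvd c k" by (auto simp: less_Suc_eq)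
  qed
  moreover have "card (insert j J) = Suc t" using J Suc.prems(1)
    by (subst card_insert_disjoint) (auto intro: finite_subset)
  ultimately show ?case using J j by (intro exI[of _ "insert j J"]) auto
qed

section \<open>Vanishing orders and root counts of integer polynomials modulo
  \<open>p\<close>\<close>

locale poly_mod_prime =
  fixes p :: nat
  assumes prime_p: "prime p"
begin

abbreviation P :: "int poly" where "P \<equiv> [:int p:]"

lemma prime_P: "prime_elem P"
  using prime_p by (simp add: prime_elem_const_poly_iff)

lemma P_dvd_iff: "P dvd f \<longleftrightarrow> (\<forall>i. int p dvd coeff f i)"
  by (simp add: const_poly_dvd_iff)

lemma P_dvd_mult: "P dvd f * g \<longleftrightarrow> P dvd f \<or> P dvd g"
  using prime_P by (simp add: prime_elem_dvd_mult_iff)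

lemma P_dvd_poly: "P dvd f \<Longrightarrow> int p dvd poly f x"
  by (auto elim!: dvdE)

lemma p_dvd_poly_cong: "P dvd f - g \<Longrightarrow> int p dvd poly f x \<longleftrightarrow> int p dvd poly g x"
  using P_dvd_poly[of "f - g" x] dvd_add[of "int p" "poly f x - poly g x" "poly g x"]
    dvd_diff[of "int p" "poly f x" "poly f x - poly g x"] by auto

lemma P_dvd_cong:
  assumes "P dvd f - g" shows "P dvd f \<longleftrightarrow> P dvd g"
  using dvd_add[OF assms, of g] dvd_diff[OF _ assms, of f] by auto

lemma P_dvd_pderiv: "P dvd f \<Longrightarrow> P dvd pderiv f"
  by (auto simp: P_dvd_iff coeff_pderiv)

lemma not_P_dvd_monic: "lead_coeff f = 1 \<Longrightarrow> \<not> P dvd f"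
proof
  assume "lead_coeff f = 1" "P dvd f"
  then have "int p dvd 1" unfolding P_dvd_iff by metis
  then show False using prime_p by (simp add: prime_nat_iff)
qed

lemma not_P_dvd_linear_power: "\<not> P dvd [:-r, 1:] ^ m"
  by (rule not_P_dvd_monic) (simp add: lead_coeff_power)

text \<open>Synthetic division by a root modulo \<open>p\<close> leaves a constant remainder
  divisible by \<open>p\<close> and lowers the degree, so splitting off roots ends; \<open>m\<close>
  is the order of vanishing at \<open>r\<close> modulo \<open>p\<close>.\<close>

lemma factor_order_mod:
  assumes "\<not> P dvd f"
  shows "\<exists>m g. P dvd f - [:-r, 1:] ^ m * g \<and> \<not> int p dvd poly g r \<and> m \<le> degree f"
  using assms
proof (induction "degree f" arbitrary: f rule: less_induct)
  case less
  show ?case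
  proof (cases "int p dvd poly f r")
    case False
    then show ?thesis by (intro exI[of _ 0] exI[of _ f]) simp
  next
    case True
    let ?q = "synthetic_div f r"
    have f: "f = [:-r, 1:] * ?q + [:poly f r:]"
      using synthetic_div_correct'[of r f] by simp
    have Pr: "P dvd [:poly f r:]" using True by (auto simp: P_dvd_iff coeff_pCons split: nat.splits)
    have nq: "\<not> P dvd ?q" using less.prems f Pr by (metis dvd_add dvd_mult)
    then have "?q \<noteq> 0" by auto
    then have deg: "degree f = Suc (degree ?q)"
      by (metis degree_synthetic_div synthetic_div_eq_0_iff diff_Suc_1 not0_implies_Suc)
    with less.hyps[of ?q] nq obtain m g where mg:
      "P dvd ?q - [:-r, 1:] ^ m * g" "\<not> int p dvd poly g r" "m \<le> degree ?q" by auto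
    have "f - [:-r, 1:] ^ Suc m * g = [:-r, 1:] * (?q - [:-r, 1:] ^ m * g) + [:poly f r:]"
      by (subst f) (simp add: algebra_simps)
    with mg(1) Pr have "P dvd f - [:-r, 1:] ^ Suc m * g" by (metis dvd_add dvd_mult)
    with mg deg show ?thesis by (intro exI[of _ "Suc m"] exI[of _ g]) auto
  qed
qed

lemma linear_dvd_mod:
  assumes "int p dvd poly f r"
  obtains g where "P dvd f - [:-r, 1:] * g"
proof -
  have "f - [:-r, 1:] * synthetic_div f r = [:poly f r:]"
    using synthetic_div_correct'[of r f] by (simp add: algebra_simps)
  moreover have "P dvd [:poly f r:]" using assms by (auto simp: P_dvd_iff coeff_pCons split: nat.splits)
  ultimately show ?thesis using that[of "synthetic_div f r"] by simp
qed

text \<open>Plays the role of coprimality of \<open>a\<close> and a power of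
  \<open>[:-y, 1:]\<close> over F_p: evaluating at \<open>y\<close> forces a root of
  \<open>h\<close>, one linear factor cancels, and induction finishes.\<close>

lemma linear_power_dvd_cancel:
  assumes "P dvd a * h - [:-y, 1:] ^ m * b" "\<not> int p dvd poly a y"
  shows "\<exists>g. P dvd h - [:-y, 1:] ^ m * g"
  using assms(1)
proof (induction m arbitrary: h b)
  case 0
  show ?case by (intro exI[of _ h]) simp
next
  case (Suc m)
  have "int p dvd poly (a * h - [:-y, 1:] ^ Suc m * b) y" by (rule P_dvd_poly[OF Suc.prems])
  then have "int p dvd poly a y * poly h y" by simp
  with assms(2) prime_p have "int p dvd poly h y"
    by (metis prime_dvd_mult_iff prime_nat_int_transfer)
  then obtain h' where h': "P dvd h - [:-y, 1:] * h'" by (rule linear_dvd_mod)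
  have "[:-y, 1:] * (a * h' - [:-y, 1:] ^ m * b) 
      = (a * h - [:-y, 1:] ^ Suc m * b) - a * (h - [:-y, 1:] * h')"
    by (simp add: algebra_simps)
  then have "P dvd [:-y, 1:] * (a * h' - [:-y, 1:] ^ m * b)"
    using Suc.prems h' by (metis dvd_diff dvd_mult)
  then have "P dvd a * h' - [:-y, 1:] ^ m * b"
    using not_P_dvd_linear_power[of y 1] by (simp only: P_dvd_mult power_one_right) blast
  with Suc.IH obtain g where g: "P dvd h' - [:-y, 1:] ^ m * g" by blast
  have "h - [:-y, 1:] ^ Suc m * g = (h - [:-y, 1:] * h') + [:-y, 1:] * (h' - [:-y, 1:] ^ m * g)"
    by (simp add: algebra_simps)
  with g h' show ?case by (metis dvd_add dvd_mult)
qed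

lemma degree_monic_mult_mod:
  assumes "lead_coeff Q = 1" "\<not> P dvd f" "P dvd f - Q * h"
  shows "degree Q \<le> degree f"
proof -
  have "\<not> P dvd h" using assms(2) dvd_add[OF assms(3), of "Q * h"] by (auto simp: P_dvd_mult)
  then have "\<exists>i. \<not> int p dvd coeff h i" by (simp add: P_dvd_iff)
  then have fin: "{i. \<not> int p dvd coeff h i} \<noteq> {}" "finite {i. \<not> int p dvd coeff h i}"
    by (auto intro!: finite_subset[of _ "{..degree h}"] simp: coeff_eq_0 not_le[symmetric] dest!: coeff_eq_0) 
       (metis coeff_eq_0 dvd_0_right not_le_imp_less)
  \<comment> \<open>The degree of \<open>h\<close> after reduction modulo \<open>p\<close>, possibly
    smaller than \<open>degree h\<close>. As \<open>Q\<close> is monic, the coefficient of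
    \<open>Q * h\<close> at \<open>degree Q + i\<close> survives the reduction.\<close>
  define i where "i = Max {i. \<not> int p dvd coeff h i}"
  have i: "\<not> int p dvd coeff h i" using Max_in[OF fin(2,1)] by (simp add: i_def)
  have hi: "int p dvd coeff h j" if "j > i" for j
    using Max_ge[OF fin(2), of j] that unfolding i_def by (metis leD mem_Collect_eq)
  have "coeff (Q * h) (degree Q + i) = coeff Q (degree Q) * coeff h i 
     + (\<Sum>j\<in>{..degree Q + i} - {degree Q}. coeff Q j * coeff h (degree Q + i - j))"
    by (simp add: coeff_mult sum.remove[of _ "degree Q"])
  moreover have "int p dvd (\<Sum>j\<in>{..degree Q + i} - {degree Q}. coeff Q j * coeff h (degree Q + i - j))"
  proof (rule dvd_sum)
    fix j assume "j \<in> {..degree Q + i} - {degree Q}"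
    then show "int p dvd coeff Q j * coeff h (degree Q + i - j)"
      by (cases "j < degree Q") (auto intro!: dvd_mult hi simp: coeff_eq_0)
  qed
  ultimately have "\<not> int p dvd coeff (Q * h) (degree Q + i)"
    using i assms(1) by (simp add: dvd_add_left_iff)
  moreover have "int p dvd coeff f (degree Q + i) - coeff (Q * h) (degree Q + i)"
    using assms(3) unfolding P_dvd_iff by simp
  ultimately have "coeff f (degree Q + i) \<noteq> 0" by auto
  then show ?thesis using le_degree[of f] by (meson add_leD1)
qed

text \<open>Powers of distinct linear factors are coprime modulo \<open>p\<close>, so their product
  divides \<open>f\<close> modulo \<open>p\<close>; being monic, it bounds the degree of
  \<open>f\<close> from below.\<close>

lemma card_roots_mod:
  assumes Y: "finite Y" and dist: "\<And>y y'. y \<in> Y \<Longrightarrow> y' \<in> Y \<Longrightarrow> y \<noteq> y' \<Longrightarrow> \<not> int p dvd y - y'"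
    and f: "\<not> P dvd f" and dvd: "\<And>y. y \<in> Y \<Longrightarrow> \<exists>h. P dvd f - [:-y, 1:] ^ M * h"
  shows "M * card Y \<le> degree f"
proof -
  have "\<exists>h. P dvd f - (\<Prod>y\<in>Y. [:-y, 1:] ^ M) * h"
    using Y dist dvd
  proof (induction Y)
    case empty
    show ?case by (intro exI[of _ f]) simp
  next
    case (insert y Y)
    let ?A = "\<Prod>y\<in>Y. [:-y, 1:] ^ M"
    from insert obtain h where h: "P dvd f - ?A * h" by auto
    obtain b where b: "P dvd f - [:-y, 1:] ^ M * b" using insert.prems(2) by auto
    have "P dvd ?A * h - [:-y, 1:] ^ M * b" 
      using dvd_diff[OF b h] by simp
    moreover have "\<not> int p dvd poly ?A y"
    proof -
      have "prime (int p)" using prime_p by simp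
      have "\<not> int p dvd (\<Prod>x\<in>Y. (y - x) ^ M)"
        using insert.hyps insert.prems(1)
        by (auto simp: prime_dvd_prod_iff[OF _ \<open>prime (int p)\<close>] dest!: prime_dvd_power[OF \<open>prime (int p)\<close>])
      then show ?thesis by (simp add: poly_prod)
    qed
    ultimately obtain g where g: "P dvd h - [:-y, 1:] ^ M * g" using linear_power_dvd_cancel by blast
    have "f - (\<Prod>y\<in>insert y Y. [:-y, 1:] ^ M) * g = (f - ?A * h) + ?A * (h - [:-y, 1:] ^ M * g)"
      using insert.hyps by (simp add: algebra_simps)
    with h g show ?case by (metis dvd_add dvd_mult)
  qed
  then obtain h where h: "P dvd f - (\<Prod>y\<in>Y. [:-y, 1:] ^ M) * h" by blast
  have l: "lead_coeff (\<Prod>y\<in>Y. [:-y, 1:] ^ M) = 1" by (simp add: lead_coeff_prod lead_coeff_power)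
  have "degree (\<Prod>y\<in>Y. [:-y, 1:] ^ M) = M * card Y"
    by (simp add: degree_prod_eq_sum_degree degree_power_eq)
  with degree_monic_mult_mod[OF l f h] show ?thesis by simp
qed

end

section \<open>Powers of shifted linear polynomials\<close>

lemma linear_mult_pderiv_power:
  "[:-r, 1:] * pderiv ([:-r, 1:] ^ m) = of_nat m * ([:-r, 1:] ^ m :: int poly)"
proof (cases m)
  case (Suc k)
  have "pderiv ([:-r, 1:] ^ m) = of_nat m * ([:-r, 1:] ^ k :: int poly)"
    unfolding Suc pderiv_power_Suc by (simp add: pderiv_pCons of_nat_poly)
  then show ?thesis by (simp only: Suc power_Suc mult_ac)
qed simp

lemma int_fermat:
  assumes "prime p"
  shows "[(y::int) ^ p = y] (mod int p)"
proof (cases "int p dvd y")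
  case True
  moreover have "p > 0" using assms prime_gt_0_nat by blast
  ultimately have "int p dvd y ^ p" by (auto intro: dvd_trans[OF _ dvd_power])
  with True show ?thesis by (simp add: cong_iff_dvd_diff)
next
  case False
  define a where "a = nat (y mod int p)"
  have p0: "p > 0" using assms prime_gt_0_nat by blast
  have a: "[int a = y] (mod int p)" using p0 by (simp add: a_def cong_def)
  have "\<not> p dvd a"
  proof
    assume "p dvd a"
    then have "int p dvd int a" by (simp only: int_dvd_int_iff)
    with False show False using cong_dvd_iff[OF a] by blast
  qed
  with assms have "[a ^ (p - 1) = 1] (mod p)" by (rule fermat_theorem)
  then have "[int a ^ (p - 1) = 1] (mod int p)" by (metis cong_int_iff of_nat_1 of_nat_power)
  then have "[int a ^ (p - 1) * int a = 1 * int a] (mod int p)" by (rule cong_scalar_right)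
  then have "[int a ^ p = int a] (mod int p)"
    using p0 by (metis mult_1 power_minus_mult)
  with a show ?thesis by (metis cong_pow cong_sym cong_trans)
qed

section \<open>A derivation adapted to the nodes and its twists\<close>

locale shifted_powers = poly_mod_prime +
  fixes n D :: nat and r :: "nat \<Rightarrow> int"
  assumes nodes: "\<And>i j. i < n \<Longrightarrow> j < n \<Longrightarrow> i \<noteq> j \<Longrightarrow> \<not> int p dvd r i - r j"
begin

abbreviation lin :: "nat \<Rightarrow> int poly" where "lin i \<equiv> [:- r i, 1:]"

definition node_poly :: "int poly" where "node_poly = (\<Prod>i<n. lin i)"
definition cofactor :: "nat \<Rightarrow> int poly" where "cofactor i = (\<Prod>k\<in>{..<n} - {i}. lin k)"
text \<open>\<open>node_poly\<close> times the logarithmic derivative of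
  \<open>node_power e\<close>.\<close>

definition log_deriv :: "(nat \<Rightarrow> nat) \<Rightarrow> int poly" where
  "log_deriv e = (\<Sum>i<n. of_nat (D * e i) * cofactor i)"
text \<open>The action of \<open>node_deriv\<close> on the coefficient of
  \<open>node_power e\<close>: \<open>node_deriv (q * node_power e) = twist_deriv e q * node_power
  e\<close>.\<close>

definition twist_deriv :: "(nat \<Rightarrow> nat) \<Rightarrow> int poly \<Rightarrow> int poly" where
  "twist_deriv e q = node_poly * pderiv q + log_deriv e * q"
definition node_power :: "(nat \<Rightarrow> nat) \<Rightarrow> int poly" where
  "node_power e = (\<Prod>i<n. lin i ^ (D * e i))"
text \<open>The factor \<open>node_poly\<close> clears the denominators of all logarithmic
  derivatives at the nodes, so differentiation stays within polynomial coefficients of small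
  degree.\<close>

definition node_deriv :: "int poly \<Rightarrow> int poly" where
  "node_deriv f = node_poly * pderiv f"

lemma node_poly_cofactor: "i < n \<Longrightarrow> node_poly = lin i * cofactor i"
  unfolding node_poly_def cofactor_def by (subst prod.remove[of _ i]) auto

lemma node_deriv_node_power: "node_deriv (node_power e) = log_deriv e * node_power e"
proof -
  have "node_poly * (prod (\<lambda>i. lin i ^ (D * e i)) ({..<n} - {i}) * pderiv (lin i ^ (D * e i)))
      = of_nat (D * e i) * cofactor i * node_power e" if "i < n" for i
  proof -
    have node_power: "node_power e = lin i ^ (D * e i) * prod (\<lambda>i. lin i ^ (D * e i)) ({..<n} - {i})"
      unfolding node_power_def using that by (subst prod.remove[of _ i]) auto
    have "lin i * cofactor i * (g * d) = cofactor i * g * (lin i * d)" for g d by (simp only: mult_ac)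
    then show ?thesis
      unfolding node_poly_cofactor[OF that] node_power
      by (simp only: linear_mult_pderiv_power) (simp only: mult_ac)
  qed
  then show ?thesis
    unfolding node_deriv_def log_deriv_def
    by (subst node_power_def) (simp add: pderiv_prod sum_distrib_left sum_distrib_right)
qed

lemma node_deriv_add: "node_deriv (f + g) = node_deriv f + node_deriv g"
  by (simp add: node_deriv_def pderiv_add algebra_simps)

lemma node_deriv_mult: "node_deriv (f * g) = node_deriv f * g + f * node_deriv g"
  by (simp add: node_deriv_def pderiv_mult algebra_simps)

lemma node_deriv_sum: "node_deriv (sum f A) = (\<Sum>a\<in>A. node_deriv (f a))"
  by (induction A rule: infinite_finite_induct) (simp_all add: node_deriv_add, simp_all add: node_deriv_def)

lemma P_dvd_node_deriv: "P dvd f \<Longrightarrow> P dvd node_deriv f"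
  by (simp add: node_deriv_def P_dvd_pderiv)

lemma twist_deriv_alt: "twist_deriv e q = node_deriv q + log_deriv e * q"
  by (simp add: twist_deriv_def node_deriv_def)

lemma twist_deriv_diff: "twist_deriv e (f - g) = twist_deriv e f - twist_deriv e g"
  by (simp add: twist_deriv_def pderiv_diff algebra_simps)

lemma twist_deriv_mult: "twist_deriv e (c * f) = node_deriv c * f + c * twist_deriv e f"
  by (simp add: twist_deriv_alt node_deriv_mult algebra_simps)

lemma twist_deriv_sum: "twist_deriv e (sum f A) = (\<Sum>a\<in>A. twist_deriv e (f a))"
  by (simp add: twist_deriv_alt node_deriv_sum sum_distrib_left sum.distrib)

lemma P_dvd_twist_deriv: "P dvd f \<Longrightarrow> P dvd twist_deriv e f"
  by (simp add: twist_deriv_alt P_dvd_node_deriv)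

lemma twist_deriv_pow_diff: "(twist_deriv e ^^ k) (f - g) = (twist_deriv e ^^ k) f - (twist_deriv e ^^ k) g"
  by (induction k) (simp_all add: twist_deriv_diff)

lemma degree_node_poly: "degree node_poly = n"
  unfolding node_poly_def by (simp add: degree_prod_eq_sum_degree)

lemma degree_log_deriv: "degree (log_deriv e) \<le> n"
  unfolding log_deriv_def
proof (rule degree_sum_le)
  fix i assume "i \<in> {..<n}"
  have "degree (cofactor i) = card ({..<n} - {i})"
    unfolding cofactor_def by (simp add: degree_prod_eq_sum_degree)
  also have "\<dots> \<le> n" by (metis card_Diff1_le card_lessThan finite_lessThan)
  finally show "degree (of_nat (D * e i) * cofactor i) \<le> n"
    using degree_mult_le[of "of_nat (D * e i)" "cofactor i"] by (simp del: of_nat_mult)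
qed simp

lemma degree_twist_deriv: "degree (twist_deriv e q) \<le> degree q + n"
  unfolding twist_deriv_def
proof (rule degree_add_le)
  show "degree (node_poly * pderiv q) \<le> degree q + n"
    using degree_mult_le[of node_poly "pderiv q"] by (simp add: degree_node_poly degree_pderiv)
  show "degree (log_deriv e * q) \<le> degree q + n"
    using degree_mult_le[of "log_deriv e" q] degree_log_deriv[of e] by linarith
qed

lemma degree_twist_deriv_pow: "degree ((twist_deriv e ^^ k) q) \<le> degree q + k * n"
  by (induction k) (auto intro: order_trans[OF degree_twist_deriv])

lemma not_P_dvd_node_power: "\<not> P dvd node_power e"
  unfolding node_power_def by (rule not_P_dvd_monic) (simp add: lead_coeff_prod lead_coeff_power)

lemma degree_node_power: "degree (node_power e) = D * (\<Sum>i<n. e i)"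
  unfolding node_power_def by (simp add: degree_prod_eq_sum_degree degree_power_eq sum_distrib_left)

lemma poly_cofactor_other:
  assumes "i < n" "k \<noteq> i" shows "poly (cofactor k) (r i) = 0"
  using assms unfolding cofactor_def by (auto simp: poly_prod)

lemma poly_cofactor_self:
  assumes "i < n" shows "\<not> int p dvd poly (cofactor i) (r i)"
proof -
  have "prime (int p)" using prime_p by simp
  then show ?thesis using nodes assms
    by (auto simp: cofactor_def poly_prod prime_dvd_prod_iff)
qed

lemma poly_log_deriv:
  assumes "i < n" shows "poly (log_deriv e) (r i) = int (D * e i) * poly (cofactor i) (r i)"
proof -
  have "poly (log_deriv e) (r i) = (\<Sum>k<n. int (D * e k) * poly (cofactor k) (r i))"
    by (simp add: log_deriv_def poly_sum)
  also have "\<dots> = (\<Sum>k\<in>{i}. int (D * e k) * poly (cofactor k) (r i))"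
    using assms by (intro sum.mono_neutral_right) (auto simp: poly_cofactor_other)
  finally show ?thesis by simp
qed

text \<open>\<open>node_poly\<close> contains \<open>lin i\<close>, so the order at the node does
  not drop. At \<open>r i\<close> the remaining factor takes the value
  \<open>(m + D * e i) * cofactor i * g\<close>, which exposes the total order
  \<open>m + D * e i\<close>.\<close>

lemma twist_deriv_linear_power:
  assumes "i < n"
  shows "twist_deriv e (lin i ^ m * g) = lin i ^ m * (of_nat m * cofactor i * g + node_poly * pderiv g + log_deriv e * g)"
proof -
  have "node_poly * pderiv (lin i ^ m) = of_nat m * cofactor i * lin i ^ m"
  proof -
    have "lin i * cofactor i * d = cofactor i * (lin i * d)" for d by (simp only: mult_ac)
    then show ?thesis
      unfolding node_poly_cofactor[OF assms]
      by (simp only: linear_mult_pderiv_power) (simp only: mult_ac)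
  qed
  moreover have "N * (x * g' + g * x') + R * (x * g) = x * (w * g + N * g' + R * g)"
    if "N * x' = w * x" for N x x' w R g' :: "int poly"
  proof -
    have "N * (x * g' + g * x') + R * (x * g) = N * x' * g + x * (N * g' + R * g)"
      by (simp add: algebra_simps)
    then show ?thesis using that by (simp add: algebra_simps)
  qed
  ultimately show ?thesis unfolding twist_deriv_def pderiv_mult by blast
qed

text \<open>If \<open>a node_power\<^sub>e\<close> and \<open>b node_power\<^sub>e\<^sub>'\<close> have the same logarithmic derivative modulo \<open>p\<close>, then their
  orders of vanishing at each node agree modulo \<open>p\<close>.\<close>

lemma exponents_eq_of_proportional:
  assumes i: "i < n" and a: "\<not> P dvd a" and b: "\<not> P dvd b"
    and da: "degree a < B" and db: "degree b < B"
    and cross: "P dvd twist_deriv e a * b - twist_deriv e' b * a"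
    and B: "B \<le> D" "K * D + B < p" and K: "e i \<le> K" "e' i \<le> K"
  shows "e i = e' i"
proof -
  \<comment> \<open>The orders \<open>m\<close> and \<open>m'\<close> of \<open>a\<close> and
    \<open>b\<close> at the node are split off; replacing \<open>a\<close> and \<open>b\<close> by
    the factored forms changes the cross expression only by multiples of \<open>p\<close>.\<close>
  obtain m g where g: "P dvd a - lin i ^ m * g" "\<not> int p dvd poly g (r i)" "m \<le> degree a"
    using factor_order_mod[OF a] by blast
  obtain m' h where h: "P dvd b - lin i ^ m' * h" "\<not> int p dvd poly h (r i)" "m' \<le> degree b"
    using factor_order_mod[OF b] by blast
  let ?a = "lin i ^ m * g" and ?b = "lin i ^ m' * h"
  have id: "A' * b' - B' * a' = (A * b - B * a) - ((A - A') * b + A' * (b - b')) + ((B - B') * a + B' * (a - a'))"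
    for A A' B B' a a' b b' :: "int poly" by (simp add: algebra_simps)
  have eq: "twist_deriv e ?a * ?b - twist_deriv e' ?b * ?a = (twist_deriv e a * b - twist_deriv e' b * a)
     - (twist_deriv e (a - ?a) * b + twist_deriv e ?a * (b - ?b)) + (twist_deriv e' (b - ?b) * a + twist_deriv e' ?b * (a - ?a))"
    unfolding twist_deriv_diff by (rule id)
  have "P dvd twist_deriv e ?a * ?b - twist_deriv e' ?b * ?a"
    unfolding eq using P_dvd_twist_deriv[OF g(1), of e] P_dvd_twist_deriv[OF h(1), of e']
    by (intro dvd_add dvd_diff cross dvd_mult[OF g(1)] dvd_mult[OF h(1)] dvd_mult2)
  moreover define C where "C = (of_nat m * cofactor i * g + node_poly * pderiv g + log_deriv e * g) * h
      - (of_nat m' * cofactor i * h + node_poly * pderiv h + log_deriv e' * h) * g"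
  have "twist_deriv e ?a * ?b - twist_deriv e' ?b * ?a = lin i ^ (m + m') * C"
  proof -
    have "x * G * (x' * h) - x' * H * (x * g) = x * x' * (G * h - H * g)" for x x' G H :: "int poly"
      by (simp add: algebra_simps)
    then show ?thesis unfolding twist_deriv_linear_power[OF i] C_def power_add by blast
  qed
  ultimately have "P dvd C" using not_P_dvd_linear_power by (simp only: P_dvd_mult) blast
  then have "int p dvd poly C (r i)" by (rule P_dvd_poly)
  moreover have "poly node_poly (r i) = 0" unfolding node_poly_cofactor[OF i] by simp
  \<comment> \<open>At the node the terms with \<open>node_poly\<close> vanish, leaving a nonzero
    residue times the difference of the total orders.\<close>
  ultimately have "int p dvd poly (cofactor i) (r i) * (poly g (r i) * (poly h (r i) *
      (int m + int (D * e i) - int m' - int (D * e' i))))"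
    by (simp add: C_def poly_log_deriv[OF i] algebra_simps)
  moreover have "prime (int p)" using prime_p by simp
  ultimately have dv: "int p dvd int m + int (D * e i) - int m' - int (D * e' i)"
    using g(2) h(2) poly_cofactor_self[OF i] by (simp add: prime_dvd_mult_iff)
  \<comment> \<open>Both total orders lie below \<open>p\<close>, which turns their congruence into
    an equality.\<close>
  have small: "D * e i + m < p" "D * e' i + m' < p"
    using B(2) g(3) h(3) da db mult_le_mono2[OF K(1), of D] mult_le_mono2[OF K(2), of D]
    unfolding mult.commute[of K D] by linarith+
  have "D * e i + m = D * e' i + m'"
  proof (rule ccontr)
    assume "D * e i + m \<noteq> D * e' i + m'"
    then have "int m + int (D * e i) - int m' - int (D * e' i) \<noteq> 0" by linarith
    from dvd_imp_le_int[OF this dv]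
    have "int p \<le> \<bar>int (D * e i + m) - int (D * e' i + m')\<bar>" by (simp add: algebra_simps)
    with small show False by linarith
  qed
  \<comment> \<open>Since \<open>m\<close> and \<open>m'\<close> are below \<open>D\<close>,
    division by \<open>D\<close> recovers the exponents.\<close>
  then have "(D * e i + m) div D = (D * e' i + m') div D" by simp
  moreover have "m < D" "m' < D" using B g(3) h(3) da db by linarith+
  ultimately show ?thesis by simp
qed

text \<open>Each application of \<open>node_deriv\<close> removes one factor
  \<open>[:-y, 1:]\<close>; modulo that factor only the term that differentiates the power every
  time remains, which produces the factorial.\<close>

lemma node_deriv_pow_linear_power:
  "\<exists>u. (node_deriv ^^ m) ([:-y, 1:] ^ m * h) = of_nat (fact m) * node_poly ^ m * h + [:-y, 1:] * u"
proof (induction m arbitrary: h)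
  case 0
  show ?case by (intro exI[of _ 0]) simp
next
  case (Suc m)
  let ?x = "[:-y, 1:]"
  have d: "node_deriv (?x ^ Suc m * h) = ?x ^ m * (of_nat (Suc m) * node_poly * h + ?x * node_poly * pderiv h)"
  proof -
    have "pderiv (?x ^ Suc m) = of_nat (Suc m) * ?x ^ m"
      by (simp only: pderiv_power_Suc) (simp add: pderiv_pCons of_nat_poly)
    then show ?thesis unfolding node_deriv_def pderiv_mult by (simp add: algebra_simps del: of_nat_Suc)
  qed
  obtain u where u: "(node_deriv ^^ m) (?x ^ m * (of_nat (Suc m) * node_poly * h + ?x * node_poly * pderiv h)) =
     of_nat (fact m) * node_poly ^ m * (of_nat (Suc m) * node_poly * h + ?x * node_poly * pderiv h) + ?x * u"
    using Suc.IH by blast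
  have "(node_deriv ^^ Suc m) (?x ^ Suc m * h) = (node_deriv ^^ m) (node_deriv (?x ^ Suc m * h))"
    by (simp only: funpow_Suc_right comp_def)
  also have "\<dots> = of_nat (fact (Suc m)) * node_poly ^ Suc m * h 
      + ?x * (u + of_nat (fact m) * node_poly ^ m * node_poly * pderiv h)"
    unfolding d u by (simp add: algebra_simps)
  finally show ?case by blast
qed

lemma P_dvd_node_deriv_pow_diff: "P dvd f - g \<Longrightarrow> P dvd (node_deriv ^^ k) f - (node_deriv ^^ k) g"
proof (induction k)
  case (Suc k)
  have "(node_deriv ^^ Suc k) f - (node_deriv ^^ Suc k) g = node_deriv ((node_deriv ^^ k) f - (node_deriv ^^ k) g)"
    by (simp add: node_deriv_def pderiv_diff algebra_simps)
  with Suc P_dvd_node_deriv show ?case by metis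
qed simp

text \<open>Taylor's criterion with \<open>node_deriv\<close> in place of the derivative: away from
  the nodes \<open>node_poly\<close> is invertible modulo \<open>p\<close>, and
  \<open>m \<le> p\<close> keeps the occurring factorials prime to \<open>p\<close>.\<close>

lemma vanishing_order:
  assumes y: "\<And>i. i < n \<Longrightarrow> \<not> int p dvd y - r i"
    and "m \<le> p" and van: "\<And>k. k < m \<Longrightarrow> int p dvd poly ((node_deriv ^^ k) f) y"
  shows "\<exists>h. P dvd f - [:-y, 1:] ^ m * h"
  using assms(2,3)
proof (induction m)
  case 0
  show ?case by (intro exI[of _ f]) simp
next
  case (Suc m)
  then obtain h where h: "P dvd f - [:-y, 1:] ^ m * h" by auto
  obtain u where u: "(node_deriv ^^ m) ([:-y, 1:] ^ m * h) = of_nat (fact m) * node_poly ^ m * h + [:-y, 1:] * u"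
    using node_deriv_pow_linear_power by blast
  have "P dvd (node_deriv ^^ m) f - (of_nat (fact m) * node_poly ^ m * h + [:-y, 1:] * u)"
    using P_dvd_node_deriv_pow_diff[OF h, of m] by (simp only: u)
  then have "int p dvd poly (of_nat (fact m) * node_poly ^ m * h + [:-y, 1:] * u) y"
    using Suc.prems(2)[of m] p_dvd_poly_cong by blast
  then have dv: "int p dvd int (fact m) * (poly node_poly y ^ m * poly h y)" by (simp add: mult.assoc of_nat_poly del: of_nat_fact)
  have pr: "prime (int p)" using prime_p by simp
  have "\<not> p dvd fact m" using prime_p Suc.prems(1) by (simp add: prime_dvd_fact_iff)
  then have "\<not> int p dvd int (fact m)" by (simp only: int_dvd_int_iff not_False_eq_True)
  moreover have "\<not> int p dvd poly node_poly y ^ m"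
    using y pr by (auto simp: node_poly_def poly_prod prime_dvd_prod_iff dest!: prime_dvd_power[OF pr])
  ultimately have "int p dvd poly h y" using dv by (simp add: prime_dvd_mult_iff[OF pr])
  then obtain g where g: "P dvd h - [:-y, 1:] * g" by (rule linear_dvd_mod)
  have "f - [:-y, 1:] ^ Suc m * g = (f - [:-y, 1:] ^ m * h) + [:-y, 1:] ^ m * (h - [:-y, 1:] * g)"
    by (simp add: algebra_simps)
  with h g show ?case by (metis dvd_add dvd_mult)
qed

end

section \<open>Independence modulo \<open>p\<close> of the functions used in the auxiliary
  polynomial\<close>

definition coeffs_poly :: "nat \<Rightarrow> (nat \<Rightarrow> int) \<Rightarrow> int poly" where
  "coeffs_poly L x = (\<Sum>l<L. monom (x l) l)"

lemma coeff_coeffs_poly: "coeff (coeffs_poly L x) l = (if l < L then x l else 0)"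
  by (simp add: coeffs_poly_def coeff_sum)

lemma degree_coeffs_poly: "L > 0 \<Longrightarrow> degree (coeffs_poly L x) < L"
  unfolding coeffs_poly_def by (intro degree_sum_less) (auto intro: le_less_trans[OF degree_monom_le])

lemma coeffs_poly_diff: "coeffs_poly L (\<lambda>l. x l - y l) = coeffs_poly L x - coeffs_poly L y"
  by (simp add: poly_eq_iff coeff_coeffs_poly)

context shifted_powers
begin

text \<open>The index \<open>(e, l)\<close> stands for \<open>node_power (ex e)\<close> times the
  \<open>(p * l)\<close>-th power of the variable. This monomial is a constant for the derivation
  modulo \<open>p\<close> and takes the value \<open>y ^ l\<close> modulo \<open>p\<close> at
  \<open>y\<close>.\<close>

definition combination :: "('e \<Rightarrow> nat \<Rightarrow> nat) \<Rightarrow> ('e \<times> nat) set \<Rightarrow> ('e \<times> nat \<Rightarrow> int poly) \<Rightarrow> int poly" where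
  "combination ex I q = (\<Sum>i\<in>I. q i * (node_power (ex (fst i)) * monom 1 (p * snd i)))"

text \<open>The coefficients of the \<open>k\<close>-th \<open>node_deriv\<close> of the
  combination, modulo \<open>p\<close>.\<close>

definition iterates :: "('e \<Rightarrow> nat \<Rightarrow> nat) \<Rightarrow> ('e \<times> nat \<Rightarrow> int poly) \<Rightarrow> nat \<Rightarrow> 'e \<times> nat \<Rightarrow> int poly" where
  "iterates ex q k i = (twist_deriv (ex (fst i)) ^^ k) (q i)"

lemma P_dvd_node_deriv_combination: "P dvd node_deriv (combination ex I q) - combination ex I (\<lambda>i. twist_deriv (ex (fst i)) (q i))"
proof -
  have "node_deriv (q i * (node_power (ex (fst i)) * monom 1 (p * snd i))) 
      - twist_deriv (ex (fst i)) (q i) * (node_power (ex (fst i)) * monom 1 (p * snd i))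
      = q i * node_power (ex (fst i)) * node_deriv (monom 1 (p * snd i))" for i
    by (simp add: node_deriv_mult node_deriv_node_power twist_deriv_alt algebra_simps)
  moreover have "P dvd node_deriv (monom 1 (p * l))" for l
    unfolding node_deriv_def by (intro dvd_mult) (auto simp: P_dvd_iff pderiv_monom)
  ultimately have "P dvd node_deriv (q i * (node_power (ex (fst i)) * monom 1 (p * snd i))) 
      - twist_deriv (ex (fst i)) (q i) * (node_power (ex (fst i)) * monom 1 (p * snd i))" for i
    by (metis dvd_mult)
  then show ?thesis unfolding combination_def node_deriv_sum sum_subtractf[symmetric] by (intro dvd_sum)
qed

lemma P_dvd_node_deriv_pow_combination: "P dvd (node_deriv ^^ k) (combination ex I q) - combination ex I (iterates ex q k)"
proof (induction k)
  case 0
  show ?case by (simp add: iterates_def[abs_def])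
next
  case (Suc k)
  have "(node_deriv ^^ Suc k) (combination ex I q) - combination ex I (iterates ex q (Suc k)) =
    node_deriv ((node_deriv ^^ k) (combination ex I q) - combination ex I (iterates ex q k)) +
    (node_deriv (combination ex I (iterates ex q k)) - combination ex I (\<lambda>i. twist_deriv (ex (fst i)) (iterates ex q k i)))"
    by (simp add: node_deriv_def pderiv_diff iterates_def[abs_def] algebra_simps)
  then show ?case using dvd_add[OF P_dvd_node_deriv[OF Suc] P_dvd_node_deriv_combination] by (simp only:)
qed

lemma P_dvd_combination_iterates:
  assumes "P dvd combination ex I q" shows "P dvd combination ex I (iterates ex q k)"
proof -
  have "P dvd (node_deriv ^^ k) (combination ex I q)"
    by (induction k) (use assms in \<open>auto intro: P_dvd_node_deriv\<close>)
  with P_dvd_cong[OF P_dvd_node_deriv_pow_combination] show ?thesis by blast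
qed

lemma degree_iterates:
  assumes "degree (q i) < L" "k \<le> s" shows "degree (iterates ex q k i) < L + s * n"
proof -
  have "degree (iterates ex q k i) \<le> degree (q i) + k * n"
    unfolding iterates_def by (rule degree_twist_deriv_pow)
  also have "\<dots> < L + s * n" using assms mult_le_mono1[of k s n] by linarith
  finally show ?thesis .
qed

lemma twist_deriv_iterates_combination:
  "twist_deriv (ex (fst i)) (\<Sum>k<t. c k * iterates ex q k i) 
   = (\<Sum>k<t. node_deriv (c k) * iterates ex q k i) + (\<Sum>k<t. c k * iterates ex q (Suc k) i)"
  by (simp add: twist_deriv_sum twist_deriv_mult iterates_def sum.distrib)

text \<open>The common node power cancels. Coefficients of degree below \<open>p\<close>, shifted by
  different multiples of \<open>p\<close>, occupy disjoint ranges, so the sum vanishes only if every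
  coefficient does.\<close>

lemma P_dvd_of_combination_same_exponent:
  assumes I: "finite I" and deg: "\<And>i. i \<in> I \<Longrightarrow> degree (w i) < p"
    and same: "\<And>i. i \<in> I \<Longrightarrow> \<not> P dvd w i \<Longrightarrow> fst i = e"
    and van: "P dvd combination ex I w" and j: "j \<in> I"
  shows "P dvd w j"
proof (rule ccontr)
  assume nj: "\<not> P dvd w j"
  let ?I = "{i \<in> I. fst i = e}"
  have "combination ex I w = (\<Sum>i\<in>?I. w i * (node_power (ex (fst i)) * monom 1 (p * snd i)))
      + (\<Sum>i\<in>I - ?I. w i * (node_power (ex (fst i)) * monom 1 (p * snd i)))"
    unfolding combination_def using I by (subst sum.subset_diff[of ?I]) auto
  moreover have "P dvd (\<Sum>i\<in>I - ?I. w i * (node_power (ex (fst i)) * monom 1 (p * snd i)))"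
    using same by (intro dvd_sum dvd_mult2) auto
  ultimately have "P dvd (\<Sum>i\<in>?I. w i * (node_power (ex (fst i)) * monom 1 (p * snd i)))"
    using van by (simp only: dvd_add_left_iff)
  also have "\<dots> = node_power (ex e) * (\<Sum>i\<in>?I. monom 1 (p * snd i) * w i)"
    unfolding sum_distrib_left by (rule sum.cong) (auto simp: mult_ac)
  finally have dv: "P dvd (\<Sum>i\<in>?I. monom 1 (p * snd i) * w i)"
    using not_P_dvd_node_power by (simp only: P_dvd_mult) blast
  have "int p dvd coeff (w j) m" for m
  proof (cases "m < p")
    case False
    then show ?thesis using deg[OF j] by (simp add: coeff_eq_0)
  next
    case True
    have "coeff (\<Sum>i\<in>?I. monom 1 (p * snd i) * w i) (p * snd j + m)
       = (\<Sum>i\<in>?I. if p * snd j + m < p * snd i then 0 else coeff (w i) (p * snd j + m - p * snd i))"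
      unfolding coeff_sum by (intro sum.cong) (simp_all add: coeff_monom_mult)
    also have "\<dots> = (\<Sum>i\<in>{j}. coeff (w i) (p * snd j + m - p * snd i))"
    proof (rule sum.mono_neutral_cong_right)
      show "{j} \<subseteq> ?I" using j same nj by auto
      show "\<forall>i\<in>?I - {j}. (if p * snd j + m < p * snd i then 0 else coeff (w i) (p * snd j + m - p * snd i)) = 0"
      proof
        fix i assume i: "i \<in> ?I - {j}"
        then have "snd i \<noteq> snd j" using same[OF j nj] by (auto simp: prod_eq_iff)
        then consider "snd i < snd j" | "snd j < snd i" by linarith
        then show "(if p * snd j + m < p * snd i then 0 else coeff (w i) (p * snd j + m - p * snd i)) = 0"
        proof cases
          case 1
          then have "p * Suc (snd i) \<le> p * snd j" by (intro mult_le_mono2) simp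
          then have "p \<le> p * snd j + m - p * snd i" by simp
          then show ?thesis using deg[of i] i by (simp add: coeff_eq_0)
        next
          case 2
          then have "p * Suc (snd j) \<le> p * snd i" by (intro mult_le_mono2) simp
          then show ?thesis using True by simp
        qed
      qed
    qed (use I in auto)
    also have "\<dots> = coeff (w j) m" by simp
    finally show ?thesis using dv[unfolded P_dvd_iff, rule_format, of "p * snd j + m"] by (simp only:)
  qed
  with nj show False by (simp add: P_dvd_iff)
qed

text \<open>The tuples obtained from a relation by iterating \<open>twist_deriv\<close> are again relations. Among their
  combinations, the pigeonhole principle finds one of controlled degree that vanishes on all but one
  of a determining set of coordinates; such a tuple is proportional to its own \<open>twist_deriv\<close>-image, so all
  its nonzero coordinates carry the same exponent vector.\<close>

theorem combination_independent:
  assumes E: "finite E" and I: "I = E \<times> {..<J}" and s: "s = card E * J"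
    and dist: "\<And>e e'. e \<in> E \<Longrightarrow> e' \<in> E \<Longrightarrow> (\<And>i. i < n \<Longrightarrow> ex e i = ex e' i) \<Longrightarrow> e = e'"
    and exK: "\<And>e i. e \<in> E \<Longrightarrow> i < n \<Longrightarrow> ex e i \<le> K"
    and deg: "\<And>i. i \<in> I \<Longrightarrow> degree (q i) < L"
    and B: "(s + 1) * (L + s * n) \<le> D" "K * D + (s + 1) * (L + s * n) < p"
    and van: "P dvd combination ex I q" and j: "j \<in> I"
  shows "P dvd q j"
proof (rule ccontr)
  assume nj: "\<not> P dvd q j"
  have finI: "finite I" and cardI: "card I = s" using E I s by (auto simp: card_cartesian_product)
  have L: "L > 0" using deg[OF j] by simp
  define v where "v = iterates ex q"
  have v0: "v 0 i = q i" for i by (simp add: v_def iterates_def)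
  have bound: "t \<le> s" if "indep_mod P t I v" for t
    using indep_mod_column_subset[OF prime_P finI that] cardI finI by (metis card_mono)
  \<comment> \<open>The length of the longest initial segment of iterates that is independent modulo
    \<open>p\<close>, a rank of Wronskian type. It is at most the number \<open>s\<close> of
    coordinates and at least 1 because \<open>q j\<close> is nonzero.\<close>
  define t where "t = (GREATEST t. indep_mod P t I v)"
  have "indep_mod P 0 I v" by (simp add: indep_mod_def)
  then have ind: "indep_mod P t I v" unfolding t_def by (rule GreatestI_nat) (use bound in blast)
  have ts: "t \<le> s" by (rule bound[OF ind])
  have "indep_mod P 1 I v" using nj j by (auto simp: indep_mod_def v0 P_dvd_mult)
  then have t1: "t \<ge> 1" unfolding t_def by (rule Greatest_le_nat) (use bound in blast)
  have "\<not> indep_mod P (Suc t) I v"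
    using Greatest_le_nat[of "\<lambda>t. indep_mod P t I v" "Suc t" s] bound unfolding t_def[symmetric] by fastforce
  \<comment> \<open>By maximality the next iterate \<open>v t\<close> depends on the earlier ones,
    and their independence makes its coefficient \<open>d t\<close> nonzero modulo
    \<open>p\<close>.\<close>
  then obtain d where d: "\<And>i. i \<in> I \<Longrightarrow> P dvd (\<Sum>k<Suc t. d k * v k i)" "\<exists>k<Suc t. \<not> P dvd d k"
    unfolding indep_mod_def by blast
  have dt: "\<not> P dvd d t"
  proof
    assume "P dvd d t"
    then have "P dvd (\<Sum>k<t. d k * v k i)" if "i \<in> I" for i
      using d(1)[OF that] by (simp add: dvd_add_left_iff)
    with ind have "\<forall>k<t. P dvd d k" unfolding indep_mod_def by blast
    with \<open>P dvd d t\<close> d(2) show False by (auto simp: less_Suc_eq)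
  qed
  obtain J0 where J0: "J0 \<subseteq> I" "card J0 = t" "indep_mod P t J0 v"
    using indep_mod_column_subset[OF prime_P finI ind] by blast
  then obtain j0 where j0: "j0 \<in> J0" using t1 by (metis card.empty ex_in_conv not_one_le_zero)
  have j0I: "j0 \<in> I" using j0 J0(1) by blast
  have finJ0: "finite J0" using J0(1) finI by (rule finite_subset)
  \<comment> \<open>Degree budget: multipliers of degree below \<open>L1\<close> give a tuple of
    degree below \<open>L2\<close>. Vanishing on the \<open>t - 1\<close> coordinates of
    \<open>J0\<close> other than \<open>j0\<close> costs \<open>(t - 1) * L2\<close> equations in
    \<open>t * L1\<close> unknowns; these are fewer than the unknowns because
    \<open>t - 1 < s\<close>.\<close>
  define L1 where "L1 = s * (L + s * n)"
  define L2 where "L2 = (s + 1) * (L + s * n)"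
  have L2: "L2 = L1 + (L + s * n)" by (simp add: L1_def L2_def)
  have s0: "s > 0" using t1 ts by simp
  have L10: "L1 > 0" using s0 L by (simp add: L1_def)
  define w where "w x i = (\<Sum>k<t. coeffs_poly L1 (\<lambda>l. x (k, l)) * v k i)" for x i
  have degw: "degree (w x i) < L2" if "i \<in> I" for x i
    unfolding w_def
  proof (rule degree_sum_less)
    fix k assume "k \<in> {..<t}"
    then have "degree (v k i) < L + s * n"
      unfolding v_def using ts deg[OF that] by (intro degree_iterates) auto
    then show "degree (coeffs_poly L1 (\<lambda>l. x (k, l)) * v k i) < L2"
      using degree_mult_le[of "coeffs_poly L1 (\<lambda>l. x (k, l))" "v k i"]
        degree_coeffs_poly[OF L10, of "\<lambda>l. x (k, l)"] L2 by linarith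
  qed (use L2 L10 in simp)
  define U where "U = {..<t} \<times> {..<L1}"
  define C where "C = (J0 - {j0}) \<times> {..<L2}"
  have cCU: "card C < card U"
  proof -
    have "card C = (t - 1) * L2" using J0 j0 finJ0 by (simp add: C_def card_cartesian_product)
    moreover have "card U = t * L1" by (simp add: U_def card_cartesian_product)
    moreover have "(t - 1) * (L + s * n) < L1"
      unfolding L1_def using t1 ts L by (intro mult_strict_right_mono) auto
    moreover have "t * L1 = (t - 1) * L1 + L1" using t1 by (metis add.commute mult_eq_if not_one_le_zero)
    ultimately show ?thesis by (simp add: L2 distrib_left)
  qed
  have dT: "coeff (w (\<lambda>j. x j - y j) (fst c)) (snd c) = coeff (w x (fst c)) (snd c) - coeff (w y (fst c)) (snd c)"
    for x y c
    by (simp add: w_def coeffs_poly_diff left_diff_distrib sum_subtractf)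
  have fU: "finite U" and fC: "finite C" using finJ0 by (simp_all add: U_def C_def)
  obtain x where x: "\<exists>j\<in>U. \<not> int p dvd x j"
      "\<And>c. c \<in> C \<Longrightarrow> int p dvd coeff (w x (fst c)) (snd c)"
    using pigeonhole_mod[OF prime_ge_2_nat[OF prime_p] fU fC cCU,
        of "\<lambda>x c. coeff (w x (fst c)) (snd c)", OF dT] by blast
  define c where "c k = coeffs_poly L1 (\<lambda>l. x (k, l))" for k
  define W where "W = w x"
  have W: "W i = (\<Sum>k<t. c k * v k i)" for i by (simp add: W_def w_def c_def)
  have c: "\<exists>k<t. \<not> P dvd c k"
  proof -
    from x(1) obtain k l where "k < t" "l < L1" "\<not> int p dvd x (k, l)" unfolding U_def by auto
    then have "\<not> int p dvd coeff (c k) l" by (simp add: c_def coeff_coeffs_poly)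
    with \<open>k < t\<close> show ?thesis unfolding P_dvd_iff by blast
  qed
  have W0: "P dvd W i" if "i \<in> J0 - {j0}" for i
    unfolding P_dvd_iff
  proof
    fix m
    show "int p dvd coeff (W i) m"
    proof (cases "m < L2")
      case True
      then show ?thesis using x(2)[of "(i, m)"] that by (simp add: C_def W_def)
    next
      case False
      then have "coeff (W i) m = 0" using degw[of i x] that J0(1) by (intro coeff_eq_0) (auto simp: W_def)
      then show ?thesis by simp
    qed
  qed
  have Wj0: "\<not> P dvd W j0"
  proof
    assume "P dvd W j0"
    with W0 have "\<forall>i\<in>J0. P dvd (\<Sum>k<t. c k * v k i)" unfolding W by blast
    with J0(3) c show False unfolding indep_mod_def by blast
  qed
  define N where "N i = twist_deriv (ex (fst i)) (W i)" for i
  \<comment> \<open>Differentiating \<open>W\<close> shifts the iterates by one. After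
    multiplication by \<open>d t\<close> the relation \<open>d\<close> removes \<open>v t\<close>,
    so \<open>d t * N i\<close> is modulo \<open>p\<close> a combination of the first
    \<open>t\<close> iterates, with the same coefficients for all \<open>i\<close>.\<close>
  define g where "g k = d t * (node_deriv (c k) + (if k = 0 then 0 else c (k - 1))) - c (t - 1) * d k" for k
  have g: "P dvd d t * N i - (\<Sum>k<t. g k * v k i)" if "i \<in> I" for i
  proof -
    obtain t' where t': "t = Suc t'" using t1 by (cases t) auto
    have "N i = (\<Sum>k<t. node_deriv (c k) * v k i) + (\<Sum>k<t. c k * v (Suc k) i)"
      unfolding N_def W v_def by (rule twist_deriv_iterates_combination)
    moreover have "(\<Sum>k<t. c k * v (Suc k) i) = (\<Sum>k<t. (if k = 0 then 0 else c (k - 1)) * v k i) + c (t - 1) * v t i"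
      unfolding t' by (subst (2) sum.lessThan_Suc_shift) (simp add: sum.lessThan_Suc)
    ultimately have "d t * N i - (\<Sum>k<t. g k * v k i) = c (t - 1) * (\<Sum>k<Suc t. d k * v k i)"
      by (simp add: g_def algebra_simps sum.distrib sum_subtractf sum_distrib_left)
    with d(1)[OF that] show ?thesis by simp
  qed
  \<comment> \<open>The combination with coefficients \<open>h\<close> represents
    \<open>d t * (W j0 * N i - N j0 * W i)\<close>. It vanishes on \<open>J0\<close>, hence all
    \<open>h k\<close> vanish modulo \<open>p\<close>, and so does the combination on all of
    \<open>I\<close>: the tuples \<open>W\<close> and \<open>N\<close> are proportional.\<close>
  define h where "h k = W j0 * g k - d t * N j0 * c k" for k
  have hsum: "(\<Sum>k<t. h k * v k i) = W j0 * (\<Sum>k<t. g k * v k i) - d t * N j0 * W i" for i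
    by (simp add: h_def W algebra_simps sum_subtractf sum_distrib_left)
  have hd: "P dvd d t * (W j0 * N i - N j0 * W i) - (\<Sum>k<t. h k * v k i)" if "i \<in> I" for i
  proof -
    have "d t * (W j0 * N i - N j0 * W i) - (\<Sum>k<t. h k * v k i) = W j0 * (d t * N i - (\<Sum>k<t. g k * v k i))"
      unfolding hsum by (simp add: algebra_simps)
    with g[OF that] show ?thesis by simp
  qed
  have "P dvd (\<Sum>k<t. h k * v k i)" if "i \<in> J0" for i
  proof -
    have "P dvd d t * (W j0 * N i - N j0 * W i)"
    proof (cases "i = j0")
      case False
      with that W0 have "P dvd W i" by blast
      then show ?thesis unfolding N_def using P_dvd_twist_deriv by (intro dvd_mult dvd_diff) auto
    qed (simp add: mult.commute)
    with P_dvd_cong[OF hd[of i]] that J0(1) show ?thesis by blast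
  qed
  with J0(3) have "\<forall>k<t. P dvd h k" unfolding indep_mod_def by blast
  then have "P dvd (\<Sum>k<t. h k * v k i)" for i by (auto intro!: dvd_sum dvd_mult2)
  then have "P dvd d t * (W j0 * N i - N j0 * W i)" if "i \<in> I" for i
    using P_dvd_cong[OF hd[OF that]] by blast
  then have cross: "P dvd W j0 * N i - N j0 * W i" if "i \<in> I" for i
    using that dt P_dvd_mult by blast
  have same: "fst i = fst j0" if "i \<in> I" "\<not> P dvd W i" for i
  proof (rule dist)
    show "fst i \<in> E" "fst j0 \<in> E" using that j0 J0(1) I by auto
    fix l assume l: "l < n"
    show "ex (fst i) l = ex (fst j0) l"
    proof (rule exponents_eq_of_proportional[OF l that(2) Wj0, where B = L2 and K = K])
      show "P dvd twist_deriv (ex (fst i)) (W i) * W j0 - twist_deriv (ex (fst j0)) (W j0) * W i"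
        using cross[OF that(1)] by (simp add: N_def mult.commute)
      show "degree (W i) < L2" "degree (W j0) < L2" using degw that(1) j0I by (auto simp: W_def)
    qed (use B l exK \<open>fst i \<in> E\<close> \<open>fst j0 \<in> E\<close> in \<open>auto simp: L2_def\<close>)
  qed
  \<comment> \<open>Every tuple of iterates is a relation, hence so is \<open>W\<close>. With a
    single exponent vector left its coordinates must vanish, against the choice of
    \<open>j0\<close>.\<close>
  have "combination ex I W = (\<Sum>k<t. c k * combination ex I (v k))"
    unfolding combination_def W sum_distrib_left sum_distrib_right
    by (subst sum.swap) (simp only: mult.assoc)
  moreover have "P dvd combination ex I (v k)" for k unfolding v_def by (rule P_dvd_combination_iterates[OF van])
  ultimately have van': "P dvd combination ex I W" by (simp add: dvd_sum)
  have "P dvd W j0"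
  proof (rule P_dvd_of_combination_same_exponent[OF finI _ same van' j0I])
    fix i assume "i \<in> I"
    then have "degree (W i) < L2" unfolding W_def by (rule degw)
    then show "degree (W i) < p" using B(2) by (simp add: L2_def)
  qed
  with Wj0 show False ..
qed

end

section \<open>The auxiliary polynomial of Stepanov's method\<close>

context shifted_powers
begin

text \<open>The auxiliary polynomial \<open>f\<close> is nonzero modulo \<open>p\<close> by
  \<open>combination_independent\<close> but vanishes to order \<open>M\<close> on \<open>Y\<close>:
  there its derivatives agree with polynomials of low degree, and making these zero identically
  costs \<open>M * (L + J + n * M)\<close> equations in \<open>s * L\<close> unknown coefficients.
  The bound compares \<open>M * card Y\<close> with the degree of \<open>f\<close>.\<close>

theorem stepanov_bound:
  fixes ex :: "'e \<Rightarrow> nat \<Rightarrow> nat"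
  assumes E: "finite E" and s: "s = card E * J"
    and dist: "\<And>e e'. e \<in> E \<Longrightarrow> e' \<in> E \<Longrightarrow> (\<And>i. i < n \<Longrightarrow> ex e i = ex e' i) \<Longrightarrow> e = e'"
    and exK: "\<And>e i. e \<in> E \<Longrightarrow> i < n \<Longrightarrow> ex e i \<le> K"
    and exT: "\<And>e. e \<in> E \<Longrightarrow> (\<Sum>i<n. ex e i) \<le> T"
    and M: "M * (L + J + n * M) < s * L"
    and B: "(s + 1) * (L + s * n) \<le> D" "K * D + (s + 1) * (L + s * n) < p"
    and Y: "finite Y" and distY: "\<And>y y'. y \<in> Y \<Longrightarrow> y' \<in> Y \<Longrightarrow> y \<noteq> y' \<Longrightarrow> \<not> int p dvd y - y'"
    and Yc: "\<And>y i. y \<in> Y \<Longrightarrow> i < n \<Longrightarrow> [(y - r i) ^ D = c i] (mod int p)"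
    and c: "\<And>i. i < n \<Longrightarrow> \<not> int p dvd c i"
  shows "M * card Y \<le> T * D + L + p * (J - 1)"
proof -
  define I where "I = E \<times> {..<J}"
  have finI: "finite I" and cardI: "card I = s" using E s by (auto simp: I_def card_cartesian_product)
  have L0: "L > 0" using M by (cases L) auto
  define q where "q x i = coeffs_poly L (\<lambda>l. x (i, l))" for x :: "('e \<times> nat) \<times> nat \<Rightarrow> int" and i
  have degq: "degree (q x i) < L" for x i unfolding q_def by (rule degree_coeffs_poly[OF L0])
  have qd: "q (\<lambda>j. x j - y j) i = q x i - q y i" for x y i by (simp add: q_def coeffs_poly_diff)
  define \<theta> where "\<theta> e = (\<Prod>i<n. c i ^ ex e i)" for e
  \<comment> \<open>What the \<open>k\<close>-th derivative becomes on \<open>Y\<close> once each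
    node power is replaced by its constant value \<open>\<theta>\<close> and the
    \<open>(p * l)\<close>-th power of the variable by the \<open>l\<close>-th. Its degree involves
    neither \<open>D\<close> nor \<open>p\<close>.\<close>
  define \<Psi> where "\<Psi> x k = (\<Sum>i\<in>I. monom (\<theta> (fst i)) (snd i) * iterates ex (q x) k i)" for x k
  have \<Psi>_diff: "\<Psi> (\<lambda>j. x j - y j) k = \<Psi> x k - \<Psi> y k" for x y k
    by (simp add: \<Psi>_def iterates_def qd twist_deriv_pow_diff right_diff_distrib sum_subtractf)
  have deg\<Psi>: "degree (\<Psi> x k) < L + J + n * M" if "k < M" for x k
    unfolding \<Psi>_def
  proof (rule degree_sum_less)
    fix i assume "i \<in> I"
    then have "snd i < J" by (auto simp: I_def)
    have "degree (iterates ex (q x) k i) < L + M * n"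
      using degq that by (intro degree_iterates) auto
    then have "degree (monom (\<theta> (fst i)) (snd i) * iterates ex (q x) k i) < snd i + (L + M * n)"
      using degree_mult_le[of "monom (\<theta> (fst i)) (snd i)" "iterates ex (q x) k i"]
        degree_monom_le[of "\<theta> (fst i)" "snd i"] by linarith
    with \<open>snd i < J\<close> show "degree (monom (\<theta> (fst i)) (snd i) * iterates ex (q x) k i) < L + J + n * M"
      by (simp add: mult.commute)
  qed (use L0 in simp)
  define U where "U = I \<times> {..<L}"
  define C where "C = {..<M} \<times> {..<L + J + n * M}"
  have fU: "finite U" and fC: "finite C" using finI by (simp_all add: U_def C_def)
  have cCU: "card C < card U" using M by (simp add: U_def C_def card_cartesian_product cardI)
  have "coeff (\<Psi> (\<lambda>j. x j - y j) (fst d)) (snd d) = coeff (\<Psi> x (fst d)) (snd d) - coeff (\<Psi> y (fst d)) (snd d)"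
    for x y d by (simp add: \<Psi>_diff)
  from pigeonhole_mod[OF prime_ge_2_nat[OF prime_p] fU fC cCU,
        of "\<lambda>x d. coeff (\<Psi> x (fst d)) (snd d)", OF this]
  obtain x where x: "\<exists>j\<in>U. \<not> int p dvd x j" "\<And>d. d \<in> C \<Longrightarrow> int p dvd coeff (\<Psi> x (fst d)) (snd d)"
    by blast
  obtain j where j: "j \<in> I" "\<not> P dvd q x j"
  proof -
    from x(1) obtain i l where "i \<in> I" "l < L" "\<not> int p dvd x (i, l)" unfolding U_def by auto
    then have "\<not> int p dvd coeff (q x i) l" by (simp add: q_def coeff_coeffs_poly)
    then have "\<not> P dvd q x i" unfolding P_dvd_iff by blast
    with \<open>i \<in> I\<close> show ?thesis using that by blast
  qed
  have \<Psi>0: "P dvd \<Psi> x k" if "k < M" for k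
    unfolding P_dvd_iff
  proof
    fix m
    show "int p dvd coeff (\<Psi> x k) m"
    proof (cases "m < L + J + n * M")
      case True
      then show ?thesis using x(2)[of "(k, m)"] that by (simp add: C_def)
    next
      case False
      then have "coeff (\<Psi> x k) m = 0" using deg\<Psi>[OF that, of x] by (intro coeff_eq_0) auto
      then show ?thesis by simp
    qed
  qed
  define f where "f = combination ex I (q x)"
  have f0: "\<not> P dvd f"
  proof
    assume "P dvd f"
    then have "P dvd q x j"
      by (intro combination_independent[OF E I_def s, where ex = ex and q = "q x" and K = K and L = L])
        (use dist exK degq B j(1) f_def in auto)
    with j(2) show False ..
  qed
  have D0: "D > 0" using B(1) L0 by (cases D) auto
  have Mp: "M \<le> p"
  proof -
    have "M * L < s * L" using M unfolding add_mult_distrib2 by linarith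
    then have "M < s" by simp
    also have "s \<le> (s + 1) * (L + s * n)" using mult_le_mono[of s "s + 1" 1 "L + s * n"] L0 by simp
    also have "\<dots> < p" using B(2) by simp
    finally show ?thesis by simp
  qed
  have order: "\<exists>h. P dvd f - [:-y, 1:] ^ M * h" if y: "y \<in> Y" for y
  proof (rule vanishing_order[OF _ Mp])
    \<comment> \<open>No node lies in \<open>Y\<close>, since the prescribed value
      \<open>c i\<close> is nonzero modulo \<open>p\<close> and \<open>D > 0\<close>.\<close>
    fix i assume i: "i < n"
    show "\<not> int p dvd y - r i"
    proof
      assume "int p dvd y - r i"
      then have "int p dvd (y - r i) ^ D" using D0 by (meson dvd_power dvd_trans)
      with c[OF i] cong_dvd_iff[OF Yc[OF y i]] show False by simp
    qed
  next
    fix k assume k: "k < M"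
    have "[poly (iterates ex (q x) k i * (node_power (ex (fst i)) * monom 1 (p * snd i))) y
        = poly (monom (\<theta> (fst i)) (snd i) * iterates ex (q x) k i) y] (mod int p)" for i
    proof -
      have "[poly (node_power (ex (fst i))) y = \<theta> (fst i)] (mod int p)"
      proof -
        have "poly (node_power (ex (fst i))) y = (\<Prod>l<n. ((y - r l) ^ D) ^ ex (fst i) l)"
          by (simp add: node_power_def poly_prod power_mult)
        moreover have "[(\<Prod>l<n. ((y - r l) ^ D) ^ ex (fst i) l) = \<theta> (fst i)] (mod int p)"
          unfolding \<theta>_def by (intro cong_prod cong_pow Yc[OF y]) auto
        ultimately show ?thesis by simp
      qed
      moreover have "[y ^ (p * snd i) = y ^ snd i] (mod int p)"
        unfolding power_mult by (intro cong_pow int_fermat prime_p)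
      ultimately have "[poly (iterates ex (q x) k i) y * (poly (node_power (ex (fst i))) y * y ^ (p * snd i))
         = poly (iterates ex (q x) k i) y * (\<theta> (fst i) * y ^ snd i)] (mod int p)"
        by (intro cong_mult cong_refl)
      then show ?thesis by (simp add: poly_monom mult_ac)
    qed
    then have "[poly (combination ex I (iterates ex (q x) k)) y = poly (\<Psi> x k) y] (mod int p)"
      unfolding combination_def \<Psi>_def poly_sum by (intro cong_sum)
    with P_dvd_poly[OF \<Psi>0[OF k], of y] have "int p dvd poly (combination ex I (iterates ex (q x) k)) y"
      using cong_dvd_iff by blast
    then show "int p dvd poly ((node_deriv ^^ k) f) y"
      unfolding f_def using p_dvd_poly_cong[OF P_dvd_node_deriv_pow_combination] by blast
  qed
  have "M * card Y \<le> degree f"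
    by (rule card_roots_mod[OF Y distY f0 order])
  \<comment> \<open>The node powers contribute \<open>T * D\<close>, the coefficients less than
    \<open>L\<close>, and the monomials at most \<open>p * (J - 1)\<close>.\<close>
  also have "degree f \<le> T * D + L + p * (J - 1)"
    unfolding f_def combination_def
  proof (rule degree_sum_le[OF finI])
    fix i assume i: "i \<in> I"
    have "degree (node_power (ex (fst i))) \<le> T * D"
      using exT[of "fst i"] i by (auto simp: degree_node_power I_def mult.commute)
    moreover have "p * snd i \<le> p * (J - 1)" using i by (intro mult_le_mono2) (auto simp: I_def)
    moreover have "degree (monom (1::int) (p * snd i)) \<le> p * snd i" by (rule degree_monom_le)
    moreover have "degree (node_power (ex (fst i)) * monom 1 (p * snd i)) \<le> degree (node_power (ex (fst i))) + degree (monom (1::int) (p * snd i))"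
      by (rule degree_mult_le)
    moreover have "degree (q x i * (node_power (ex (fst i)) * monom 1 (p * snd i))) \<le> 
      degree (q x i) + degree (node_power (ex (fst i)) * monom 1 (p * snd i))"
      by (rule degree_mult_le)
    ultimately show "degree (q x i * (node_power (ex (fst i)) * monom 1 (p * snd i))) \<le> T * D + L + p * (J - 1)"
      using degq[of x i] by linarith
  qed
  finally show ?thesis .
qed

end

section \<open>Product sets\<close>

text \<open>Slice by the last coordinate. A slice of size \<open>z c\<close> embeds both into the
  first projection and into the product of the corresponding slices of the other two, of sizes
  \<open>x c\<close> and \<open>y c\<close>; Cauchy-Schwarz sums over the slices.\<close>

lemma loomis_whitney:
  fixes X :: "('a \<times> 'b \<times> 'c) set"
  assumes X: "finite X"
  shows "(card X)\<^sup>2 \<le> card ((\<lambda>(a, b, c). (a, b)) ` X) * card ((\<lambda>(a, b, c). (b, c)) ` X)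
           * card ((\<lambda>(a, b, c). (a, c)) ` X)"
proof -
  let ?P = "(\<lambda>(a, b, c). (a, b)) ` X" and ?Q = "(\<lambda>(a, b, c). (b, c)) ` X"
  let ?R = "(\<lambda>(a, b, c). (a, c)) ` X" and ?C = "(\<lambda>(a, b, c). c) ` X"
  define z where "z c = card {t \<in> X. (\<lambda>(a, b, c). c) t = c}" for c
  define x where "x c = card {t \<in> ?R. snd t = c}" for c
  define y where "y c = card {t \<in> ?Q. snd t = c}" for c
  have zs: "card X = (\<Sum>c\<in>?C. z c)"
    using sum.image_gen[OF X, of "\<lambda>_. 1::nat" "\<lambda>(a, b, c). c"] by (simp add: z_def)
  have "snd ` ?R = ?C" by force
  with sum.image_gen[of ?R "\<lambda>_. 1::nat" snd] X have xs: "card ?R = (\<Sum>c\<in>?C. x c)"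
    by (simp add: x_def)
  have "snd ` ?Q = ?C" by force
  with sum.image_gen[of ?Q "\<lambda>_. 1::nat" snd] X have ys: "card ?Q = (\<Sum>c\<in>?C. y c)"
    by (simp add: y_def)
  have z1: "z c \<le> card ?P" for c
  proof -
    have "inj_on (\<lambda>(a, b, c). (a, b)) {t \<in> X. (\<lambda>(a, b, c). c) t = c}"
      by (auto simp: inj_on_def)
    then show ?thesis unfolding z_def by (rule card_inj_on_le) (use X in force)+
  qed
  have z2: "z c \<le> x c * y c" for c
  proof -
    have "inj_on (\<lambda>(a, b, c). ((a, c), (b, c))) {t \<in> X. (\<lambda>(a, b, c). c) t = c}"
      by (auto simp: inj_on_def)
    moreover have "(\<lambda>(a, b, c). ((a, c), (b, c))) ` {t \<in> X. (\<lambda>(a, b, c). c) t = c}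
        \<subseteq> {t \<in> ?R. snd t = c} \<times> {t \<in> ?Q. snd t = c}" by force
    ultimately have "z c \<le> card ({t \<in> ?R. snd t = c} \<times> {t \<in> ?Q. snd t = c})"
      unfolding z_def using X by (intro card_inj_on_le) auto
    then show ?thesis by (simp add: card_cartesian_product x_def y_def)
  qed
  \<comment> \<open>Cauchy-Schwarz in pairwise form, free of square roots: multiply the two slice
    estimates and apply \<open>4 * (u * v) \<le> (u + v)\<^sup>2\<close>.\<close>
  have key: "2 * (z c * z d) \<le> card ?P * (x c * y d + x d * y c)" for c d
  proof (rule power2_le_imp_le)
    have "(z c)\<^sup>2 \<le> card ?P * (x c * y c)" "(z d)\<^sup>2 \<le> card ?P * (x d * y d)"
      unfolding power2_eq_square using z1 z2 by (simp_all add: mult_le_mono)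
    then have "(z c)\<^sup>2 * (z d)\<^sup>2 \<le> (card ?P * (x c * y c)) * (card ?P * (x d * y d))"
      by (rule mult_le_mono)
    then have "(2 * (z c * z d))\<^sup>2 \<le> (card ?P)\<^sup>2 * (4 * ((x c * y d) * (x d * y c)))"
      by (simp add: power2_eq_square algebra_simps)
    also have "4 * (u * v) \<le> (u + v)\<^sup>2" for u v :: nat
    proof -
      have "4 * (int u * int v) \<le> (int u + int v)\<^sup>2"
        using zero_le_power2[of "int u - int v"] by (simp add: power2_eq_square algebra_simps)
      then show ?thesis by (metis (mono_tags) of_nat_add of_nat_le_iff of_nat_mult of_nat_numeral of_nat_power)
    qed
    then have "(card ?P)\<^sup>2 * (4 * ((x c * y d) * (x d * y c))) \<le> (card ?P)\<^sup>2 * (x c * y d + x d * y c)\<^sup>2"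
      by (rule mult_le_mono2)
    finally show "(2 * (z c * z d))\<^sup>2 \<le> (card ?P * (x c * y d + x d * y c))\<^sup>2"
      by (simp add: power_mult_distrib)
  qed simp
  have "2 * (card X)\<^sup>2 = (\<Sum>c\<in>?C. \<Sum>d\<in>?C. 2 * (z c * z d))"
    unfolding power2_eq_square zs sum_product by (simp add: sum_distrib_left)
  also have "\<dots> \<le> (\<Sum>c\<in>?C. \<Sum>d\<in>?C. card ?P * (x c * y d + x d * y c))"
    by (intro sum_mono key)
  also have "\<dots> = card ?P * ((\<Sum>c\<in>?C. \<Sum>d\<in>?C. x c * y d) + (\<Sum>c\<in>?C. \<Sum>d\<in>?C. x d * y c))"
    by (simp add: sum_distrib_left sum.distrib distrib_left)
  also have "(\<Sum>c\<in>?C. \<Sum>d\<in>?C. x d * y c) = (\<Sum>c\<in>?C. \<Sum>d\<in>?C. x c * y d)"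
    by (rule sum.swap)
  also have "(\<Sum>c\<in>?C. \<Sum>d\<in>?C. x c * y d) = card ?R * card ?Q"
    unfolding xs ys sum_product ..
  finally have "(card X)\<^sup>2 \<le> card ?P * (card ?R * card ?Q)" unfolding distrib_left by linarith
  then show ?thesis by (simp only: mult_ac)
qed

text \<open>Choosing the lexicographically least representation of every element makes each
  two-dimensional projection inject into the corresponding pairwise product.\<close>

lemma card_triple_product:
  fixes A :: "'a::linorder set" and B :: "'b::linorder set" and C :: "'c::linorder set"
  assumes fin: "finite A" "finite B" "finite C"
    and f1: "\<And>a a' b b' c. a \<in> A \<Longrightarrow> a' \<in> A \<Longrightarrow> b \<in> B \<Longrightarrow> b' \<in> B \<Longrightarrow> c \<in> C
      \<Longrightarrow> g1 a b = g1 a' b' \<Longrightarrow> f a b c = f a' b' c"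
    and f2: "\<And>a b b' c c'. a \<in> A \<Longrightarrow> b \<in> B \<Longrightarrow> b' \<in> B \<Longrightarrow> c \<in> C \<Longrightarrow> c' \<in> C
      \<Longrightarrow> g2 b c = g2 b' c' \<Longrightarrow> f a b c = f a b' c'"
    and f3: "\<And>a a' b c c'. a \<in> A \<Longrightarrow> a' \<in> A \<Longrightarrow> b \<in> B \<Longrightarrow> c \<in> C \<Longrightarrow> c' \<in> C
      \<Longrightarrow> g3 a c = g3 a' c' \<Longrightarrow> f a b c = f a' b c'"
  shows "(card ((\<lambda>(a, b, c). f a b c) ` (A \<times> B \<times> C)))\<^sup>2
     \<le> card ((\<lambda>(a, b). g1 a b) ` (A \<times> B)) * card ((\<lambda>(b, c). g2 b c) ` (B \<times> C))
       * card ((\<lambda>(a, c). g3 a c) ` (A \<times> C))"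
proof -
  define F where "F = (\<lambda>(a, b, c). f a b c)"
  define T where "T s = {t \<in> A \<times> B \<times> C. F t = s}" for s
  define X where "X = (\<lambda>s. Min (T s)) ` F ` (A \<times> B \<times> C)"
  have finT: "finite (T s)" for s unfolding T_def using fin by auto
  have rep: "Min (T s) \<in> T s" if "s \<in> F ` (A \<times> B \<times> C)" for s
    using that by (intro Min_in finT) (auto simp: T_def)
  have "inj_on (\<lambda>s. Min (T s)) (F ` (A \<times> B \<times> C))"
  proof (rule inj_onI)
    fix s s' assume "s \<in> F ` (A \<times> B \<times> C)" "s' \<in> F ` (A \<times> B \<times> C)" "Min (T s) = Min (T s')"
    with rep[of s] rep[of s'] show "s = s'" unfolding T_def by auto
  qed
  then have cX: "card X = card (F ` (A \<times> B \<times> C))" unfolding X_def by (rule card_image)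
  have finX: "finite X" unfolding X_def using fin by auto
  have XA: "a \<in> A" "b \<in> B" "c \<in> C" if "(a, b, c) \<in> X" for a b c
  proof -
    from that obtain s where "s \<in> F ` (A \<times> B \<times> C)" "(a, b, c) = Min (T s)" unfolding X_def by auto
    with rep[of s] show "a \<in> A" "b \<in> B" "c \<in> C" unfolding T_def by auto
  qed
  have least: "(a, b, c) \<le> (a', b', c')"
    if "(a, b, c) \<in> X" "a' \<in> A" "b' \<in> B" "c' \<in> C" "f a b c = f a' b' c'" for a b c a' b' c'
  proof -
    from that(1) obtain s where s: "s \<in> F ` (A \<times> B \<times> C)" "(a, b, c) = Min (T s)" unfolding X_def by auto
    have "(a, b, c) \<in> T s" using rep[OF s(1)] s(2) by simp
    then have "(a', b', c') \<in> T s" using that(2-5) by (auto simp: T_def F_def)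
    then show ?thesis unfolding s(2) by (intro Min_le finT)
  qed
  have 1: "card ((\<lambda>(a, b, c). (a, b)) ` X) \<le> card ((\<lambda>(a, b). g1 a b) ` (A \<times> B))"
  proof (rule card_inj_on_le)
    show "inj_on (\<lambda>(a, b). g1 a b) ((\<lambda>(a, b, c). (a, b)) ` X)"
    proof (rule inj_onI, clarify)
      fix a b c a' b' c' assume h: "(a, b, c) \<in> X" "(a', b', c') \<in> X" "g1 a b = g1 a' b'"
      \<comment> \<open>Exchanging the pairs \<open>(a, b)\<close> and \<open>(a', b')\<close>
        preserves the value of \<open>f\<close> for either third coordinate. Minimality of both
        triples then gives lexicographic inequalities in both directions.\<close>
      have "(a, b, c) \<le> (a', b', c)"
        using h(1) XA[OF h(1)] XA[OF h(2)] f1[OF _ _ _ _ _ h(3)] by (intro least) auto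
      moreover have "(a', b', c') \<le> (a, b, c')"
        using h(2) XA[OF h(1)] XA[OF h(2)] f1[OF _ _ _ _ _ h(3)[symmetric]] by (intro least) auto
      ultimately show "a = a' \<and> b = b'" by (auto simp: less_eq_prod_def)
    qed
  qed (use XA fin in auto)
  have 2: "card ((\<lambda>(a, b, c). (b, c)) ` X) \<le> card ((\<lambda>(b, c). g2 b c) ` (B \<times> C))"
  proof (rule card_inj_on_le)
    show "inj_on (\<lambda>(b, c). g2 b c) ((\<lambda>(a, b, c). (b, c)) ` X)"
    proof (rule inj_onI, clarify)
      fix a b c a' b' c' assume h: "(a, b, c) \<in> X" "(a', b', c') \<in> X" "g2 b c = g2 b' c'"
      have "(a, b, c) \<le> (a, b', c')"
        using h(1) XA[OF h(1)] XA[OF h(2)] f2[OF _ _ _ _ _ h(3)] by (intro least) auto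
      moreover have "(a', b', c') \<le> (a', b, c)"
        using h(2) XA[OF h(1)] XA[OF h(2)] f2[OF _ _ _ _ _ h(3)[symmetric]] by (intro least) auto
      ultimately show "b = b' \<and> c = c'" by (auto simp: less_eq_prod_def)
    qed
  qed (use XA fin in auto)
  have 3: "card ((\<lambda>(a, b, c). (a, c)) ` X) \<le> card ((\<lambda>(a, c). g3 a c) ` (A \<times> C))"
  proof (rule card_inj_on_le)
    show "inj_on (\<lambda>(a, c). g3 a c) ((\<lambda>(a, b, c). (a, c)) ` X)"
    proof (rule inj_onI, clarify)
      fix a b c a' b' c' assume h: "(a, b, c) \<in> X" "(a', b', c') \<in> X" "g3 a c = g3 a' c'"
      have "(a, b, c) \<le> (a', b, c')"
        using h(1) XA[OF h(1)] XA[OF h(2)] f3[OF _ _ _ _ _ h(3)] by (intro least) auto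
      moreover have "(a', b', c') \<le> (a, b', c)"
        using h(2) XA[OF h(1)] XA[OF h(2)] f3[OF _ _ _ _ _ h(3)[symmetric]] by (intro least) auto
      ultimately show "a = a' \<and> c = c'" by (auto simp: less_eq_prod_def)
    qed
  qed (use XA fin in auto)
  have "(card X)\<^sup>2 \<le> card ((\<lambda>(a, b, c). (a, b)) ` X) * card ((\<lambda>(a, b, c). (b, c)) ` X)
           * card ((\<lambda>(a, b, c). (a, c)) ` X)" by (rule loomis_whitney[OF finX])
  also have "\<dots> \<le> card ((\<lambda>(a, b). g1 a b) ` (A \<times> B)) * card ((\<lambda>(b, c). g2 b c) ` (B \<times> C))
       * card ((\<lambda>(a, c). g3 a c) ` (A \<times> C))"
    by (intro mult_le_mono 1 2 3)
  finally show ?thesis unfolding cX F_def .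
qed

section \<open>From the linear forms \<open>a * y + l\<close> to the nodes\<close>

lemma int_inverse_mod:
  assumes "prime p" "\<not> int p dvd a"
  shows "\<exists>b. [a * b = 1] (mod int p)"
proof -
  have "prime (int p)" using assms by simp
  then have "coprime a (int p)" using assms(2) by (metis coprime_commute prime_imp_coprime)
  then show ?thesis by (rule cong_solve_coprime_int)
qed

text \<open>Dividing \<open>a * y + l\<close> by \<open>a\<close> modulo \<open>p\<close> turns it
  into \<open>y - r\<close> with node \<open>r = - l / a\<close>, and the prescribed value into
  \<open>\<tau> a / a ^ D\<close>. As \<open>l\<close> is nonzero, distinct elements of
  \<open>X\<close> give distinct nodes.\<close>

theorem shifted_product_bound:
  fixes X Y :: "int set" and l :: int and \<tau> :: "int \<Rightarrow> int" and ex :: "'e \<Rightarrow> nat \<Rightarrow> nat"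
  assumes p: "prime p" and X: "finite X" "\<And>a. a \<in> X \<Longrightarrow> \<not> int p dvd a"
    and Xd: "\<And>a a'. a \<in> X \<Longrightarrow> a' \<in> X \<Longrightarrow> a \<noteq> a' \<Longrightarrow> \<not> int p dvd a - a'"
    and Y: "Y \<subseteq> {0..<int p}" and l: "\<not> int p dvd l"
    and XY: "\<And>a y. a \<in> X \<Longrightarrow> y \<in> Y \<Longrightarrow> [(a * y + l) ^ D = \<tau> a] (mod int p)"
    and \<tau>: "\<And>a. a \<in> X \<Longrightarrow> \<not> int p dvd \<tau> a"
    and n: "n = card X"
    and E: "finite E" "s = card E * J"
      "\<And>e e'. e \<in> E \<Longrightarrow> e' \<in> E \<Longrightarrow> (\<And>i. i < n \<Longrightarrow> ex e i = ex e' i) \<Longrightarrow> e = e'"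
      "\<And>e i. e \<in> E \<Longrightarrow> i < n \<Longrightarrow> ex e i \<le> K"
      "\<And>e. e \<in> E \<Longrightarrow> (\<Sum>i<n. ex e i) \<le> T"
    and M: "M * (L + J + n * M) < s * L"
    and B: "(s + 1) * (L + s * n) \<le> D" "K * D + (s + 1) * (L + s * n) < p"
  shows "M * card Y \<le> T * D + L + p * (J - 1)"
proof -
  have pr: "prime (int p)" using p by simp
  obtain h where h: "bij_betw h {..<n} X" using ex_bij_betw_nat_finite[OF X(1)] n atLeast0LessThan by auto
  have hX: "h i \<in> X" if "i < n" for i using h that by (auto simp: bij_betw_def)
  define iv where "iv a = (SOME b. [a * b = 1] (mod int p))" for a
  have iv: "[a * iv a = 1] (mod int p)" if "\<not> int p dvd a" for a
    unfolding iv_def by (rule someI_ex[OF int_inverse_mod[OF p that]])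
  have ivn: "\<not> int p dvd iv a" if "a \<in> X" for a
  proof
    assume "int p dvd iv a"
    then have "int p dvd a * iv a" by simp
    with iv[OF X(2)[OF that]] have "int p dvd 1" using cong_dvd_iff by blast
    with pr show False by (simp add: not_prime_unit)
  qed
  define r where "r i = - (l * iv (h i))" for i
  define c where "c i = \<tau> (h i) * iv (h i) ^ D" for i
  interpret shifted_powers p n D r
  proof
    show "prime p" by (rule p)
    fix i j assume ij: "i < n" "j < n" "i \<noteq> j"
    have hij: "h i \<noteq> h j" using h ij by (auto simp: bij_betw_def inj_on_def)
    show "\<not> int p dvd r i - r j"
    proof
      assume "int p dvd r i - r j"
      then have "int p dvd l * (iv (h j) - iv (h i))" by (simp add: r_def algebra_simps)
      then have "[iv (h j) = iv (h i)] (mod int p)"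
        using l by (simp add: prime_dvd_mult_iff[OF pr] cong_iff_dvd_diff)
      then have "[h i * (h j * iv (h j)) = h j * (h i * iv (h i))] (mod int p)"
        by (metis (no_types, lifting) cong_scalar_left mult.left_commute)
      moreover have "[h i * (h j * iv (h j)) = h i * 1] (mod int p)" 
        by (intro cong_scalar_left iv X(2) hX ij)
      moreover have "[h j * (h i * iv (h i)) = h j * 1] (mod int p)"
        by (intro cong_scalar_left iv X(2) hX ij)
      ultimately have "[h i = h j] (mod int p)" by (metis cong_sym cong_trans mult.right_neutral)
      then show False using Xd[OF hX[OF ij(1)] hX[OF ij(2)] hij] by (simp add: cong_iff_dvd_diff)
    qed
  qed
  show ?thesis
  proof (rule stepanov_bound[OF E M B])
    show "finite Y" using Y by (rule finite_subset) simp
    show "\<not> int p dvd y - y'" if "y \<in> Y" "y' \<in> Y" "y \<noteq> y'" for y y'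
      using that Y by (metis atLeastLessThan_iff mod_eq_dvd_iff mod_pos_pos_trivial subset_iff)
    show "\<not> int p dvd c i" if "i < n" for i
      using \<tau>[OF hX[OF that]] ivn[OF hX[OF that]] 
      by (auto simp: c_def prime_dvd_mult_iff[OF pr] dest: prime_dvd_power[OF pr])
    show "[(y - r i) ^ D = c i] (mod int p)" if "y \<in> Y" "i < n" for y i
    proof -
      let ?a = "h i"
      have "[iv ?a * (?a * y + l) = y - r i] (mod int p)"
      proof -
        have "[?a * iv ?a * y + l * iv ?a = 1 * y + l * iv ?a] (mod int p)"
          by (intro cong_add cong_mult iv X(2) hX that(2) cong_refl)
        then show ?thesis by (simp add: r_def algebra_simps)
      qed
      then have "[(iv ?a * (?a * y + l)) ^ D = (y - r i) ^ D] (mod int p)" by (rule cong_pow)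
      moreover have "[iv ?a ^ D * (?a * y + l) ^ D = iv ?a ^ D * \<tau> ?a] (mod int p)"
        by (intro cong_scalar_left XY hX that)
      ultimately show ?thesis unfolding c_def power_mult_distrib
        by (metis cong_sym cong_trans mult.commute)
    qed
  qed auto
qed

section \<open>Bounds for the factors\<close>

text \<open>The pair \<open>(j, i)\<close> stands for the product of the nodes \<open>i\<close> and \<open>j\<close>, where the index \<open>n\<close> is a
  dummy factor \<open>1\<close>; squares of nodes and the constant \<open>1\<close> occur only for \<open>u = 1\<close>.\<close>

definition pair_index :: "nat \<Rightarrow> nat \<Rightarrow> (nat \<times> nat) set" where
  "pair_index n u = (SIGMA j:{..n}. {..<j + u})"

definition pair_exp :: "nat \<times> nat \<Rightarrow> nat \<Rightarrow> nat" where
  "pair_exp e k = (if k = fst e then 1 else 0) + (if k = snd e then 1 else 0)"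

lemma card_pair_index: "2 * card (pair_index n u) = (n + 1) * (n + 2 * u)"
proof -
  have "card (pair_index n u) = (\<Sum>j\<le>n. j + u)" by (simp add: pair_index_def card_SigmaI)
  also have "2 * \<dots> = (n + 1) * (n + 2 * u)" by (induction n) (simp_all add: algebra_simps)
  finally show ?thesis .
qed

text \<open>With \<open>u \<le> 1\<close> the second component never exceeds the first, so a pair is
  a multiset of two indices; the invisible dummy \<open>n\<close> is recovered because all multisets
  have size two.\<close>

lemma pair_exp_inj:
  assumes "u \<le> 1" "e \<in> pair_index n u" "e' \<in> pair_index n u"
    and eq: "\<And>k. k < n \<Longrightarrow> pair_exp e k = pair_exp e' k"
  shows "e = e'"
proof -
  obtain j i j' i' where e: "e = (j, i)" "e' = (j', i')" by (metis surj_pair)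
  have b: "i \<le> j" "j \<le> n" "i' \<le> j'" "j' \<le> n" using assms(1-3) by (auto simp: e pair_index_def)
  have ii: "i = i'"
  proof (rule ccontr)
    assume "i \<noteq> i'"
    then consider "i < i'" | "i' < i" by linarith
    then show False using b eq[of i] eq[of i'] by cases (simp_all add: e pair_exp_def)
  qed
  have "j = j'"
  proof (rule ccontr)
    assume "j \<noteq> j'"
    then consider "j < j'" | "j' < j" by linarith
    then show False using b eq[of j] eq[of j'] by cases (simp_all add: e pair_exp_def ii)
  qed
  with ii show ?thesis by (simp add: e)
qed

lemma pair_exp_le:
  assumes "u \<le> 1" "e \<in> pair_index n u" shows "pair_exp e k \<le> 1 + u"
  using assms by (auto simp: pair_index_def pair_exp_def)

lemma pair_exp_sum: "(\<Sum>k<n. pair_exp e k) \<le> 2"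
proof -
  have "(\<Sum>k<n. pair_exp e k) = (\<Sum>k<n. if k = fst e then 1 else 0) + (\<Sum>k<n. if k = snd e then 1 else 0)"
    by (simp add: pair_exp_def sum.distrib)
  also have "\<dots> \<le> 2" by simp
  finally show ?thesis .
qed

text \<open>Stepanov's bound with \<open>J = 1\<close> and products of at most two nodes, of total
  degree at most \<open>2 * D\<close>. For \<open>u = 1\<close> squares occur, which raises the
  largest exponent to 2 and asks for roughly \<open>2 * D < p\<close>.\<close>

lemma pair_bound:
  fixes X Y :: "int set" and l :: int
  assumes p: "prime p" and X: "X \<subseteq> {1..<int p}" and Y: "Y \<subseteq> {0..<int p}" and l: "\<not> int p dvd l"
    and XY: "\<And>a y. a \<in> X \<Longrightarrow> y \<in> Y \<Longrightarrow> [(a * y + l) ^ D = 1] (mod int p)"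
    and n: "n = card X" and u: "u \<le> 1" and s: "2 * s = (n + 1) * (n + 2 * u)"
    and M: "M * (L + 1 + n * M) < s * L"
    and B: "(s + 1) * (L + s * n) \<le> D" "(1 + u) * D + (s + 1) * (L + s * n) < p"
  shows "M * card Y \<le> 2 * D + L"
proof -
  have "M * card Y \<le> 2 * D + L + p * (1 - 1)"
  proof (rule shifted_product_bound[where \<tau> = "\<lambda>_. 1" and E = "pair_index n u"
        and ex = pair_exp and K = "1 + u" and s = s and n = n, OF p _ _ _ Y l XY _ n])
    show "finite X" using X by (rule finite_subset) simp
    show "\<not> int p dvd a" if "a \<in> X" for a using that X zdvd_not_zless by auto
    show "\<not> int p dvd a - a'" if "a \<in> X" "a' \<in> X" "a \<noteq> a'" for a a'
    proof -
      have "0 \<le> a" "a < int p" "0 \<le> a'" "a' < int p" using that X by auto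
      then show ?thesis using that(3) by (metis mod_eq_dvd_iff mod_pos_pos_trivial)
    qed
    show "\<not> int p dvd 1" using p by (simp add: prime_nat_iff)
    show "finite (pair_index n u)" by (simp add: pair_index_def)
    show "s = card (pair_index n u) * 1" using card_pair_index[of n u] s by simp
    show "e = e'" if "e \<in> pair_index n u" "e' \<in> pair_index n u" "\<And>i. i < n \<Longrightarrow> pair_exp e i = pair_exp e' i" for e e'
      using pair_exp_inj[OF u that] .
    show "pair_exp e i \<le> 1 + u" if "e \<in> pair_index n u" for e i
      using pair_exp_le[OF u that] .
    show "(\<Sum>i<n. pair_exp e i) \<le> 2" for e by (rule pair_exp_sum)
  qed (use M B in auto)
  then show ?thesis by simp
qed

lemma small_factor_bound:
  fixes X Y :: "int set" and l :: int
  assumes p: "prime p" and X: "X \<subseteq> {1..<int p}" and Y: "Y \<subseteq> {0..<int p}" and l: "\<not> int p dvd l"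
    and XY: "\<And>a y. a \<in> X \<Longrightarrow> y \<in> Y \<Longrightarrow> [(a * y + l) ^ D = 1] (mod int p)"
    and n: "n = card X" and u: "u \<le> 1" and n2: "n \<ge> 2" and u4: "u = 1 \<or> n \<ge> 4"
    and D: "45 * n ^ 5 \<le> D" "(2 + u) * D < p"
  shows "n * card Y + 1 < D"
proof -
  \<comment> \<open>Just above \<open>2 * n\<close>, so that \<open>2 * n * D / M\<close> stays
    below \<open>D\<close> by a fixed proportion. \<open>L\<close> is the least value with
    \<open>M * (1 + n * M) < L\<close>, which makes \<open>s \<ge> M + 1\<close> products
    enough.\<close>
  define M where "M = 2 * n + 1"
  define L where "L = M * (1 + n * M) + 1"
  define s where "s = card (pair_index n u)"
  have s: "2 * s = (n + 1) * (n + 2 * u)" unfolding s_def by (rule card_pair_index)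
  have "2 * (2 * n + 2) \<le> 2 * s"
  proof -
    \<comment> \<open>The alternative \<open>u = 1\<close> or \<open>n \<ge> 4\<close> is what
      provides \<open>2 * n + 2\<close> products, one more than \<open>M\<close>.\<close>
    have "n + 2 * u \<ge> 4" using n2 u4 by auto
    then have "(n + 1) * 4 \<le> (n + 1) * (n + 2 * u)" by (rule mult_le_mono2)
    then show ?thesis using s by simp
  qed
  then have sM: "s \<ge> M + 1" by (simp add: M_def)
  have s2: "s \<le> 2 * n\<^sup>2"
  proof -
    have "2 * s \<le> (2 * n) * (2 * n)" unfolding s using u n2 by (intro mult_le_mono) auto
    then show ?thesis by (simp add: power2_eq_square)
  qed
  have L13: "L \<le> 13 * n ^ 3"
  proof -
    have "M \<le> 3 * n" using n2 by (simp add: M_def)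
    then have "n * M \<le> 3 * n\<^sup>2" by (simp add: power2_eq_square)
    moreover have "1 \<le> n\<^sup>2" "1 \<le> n ^ 3" using n2 by simp_all
    ultimately have "M * (1 + n * M) \<le> (3 * n) * (4 * n\<^sup>2)" using \<open>M \<le> 3 * n\<close> by (intro mult_le_mono) linarith+
    also have "\<dots> = 12 * n ^ 3" by (simp add: power2_eq_square power3_eq_cube)
    finally show ?thesis unfolding L_def using \<open>1 \<le> n ^ 3\<close> by linarith
  qed
  have M1: "M * (L + 1 + n * M) < s * L"
  proof -
    have "M * (L + 1 + n * M) = M * L + M * (1 + n * M)" by (simp add: algebra_simps)
    also have "\<dots> < M * L + L" unfolding L_def by simp
    also have "\<dots> = (M + 1) * L" by simp
    also have "\<dots> \<le> s * L" using sM by (rule mult_le_mono1)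
    finally show ?thesis .
  qed
  have B: "(s + 1) * (L + s * n) \<le> D"
  proof -
    have "1 \<le> n\<^sup>2" using n2 by simp
    then have a: "s + 1 \<le> 3 * n\<^sup>2" using s2 by linarith
    have "s * n \<le> 2 * n\<^sup>2 * n" using s2 by (rule mult_le_mono1)
    also have "\<dots> = 2 * n ^ 3" by (simp add: power2_eq_square power3_eq_cube)
    finally have "L + s * n \<le> 15 * n ^ 3" using L13 by linarith
    with a have "(s + 1) * (L + s * n) \<le> (3 * n\<^sup>2) * (15 * n ^ 3)" by (rule mult_le_mono)
    also have "\<dots> = 45 * n ^ 5" by (simp add: power_add[symmetric])
    finally show ?thesis using D(1) by simp
  qed
  have B': "(1 + u) * D + (s + 1) * (L + s * n) < p"
    using B D(2) by (simp add: algebra_simps)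
  have bd: "M * card Y \<le> 2 * D + L"
    by (rule pair_bound[OF p X Y l XY n u s M1 B B'])
  \<comment> \<open>The error terms must fit into the gap
    \<open>M * D - 2 * n * D = D\<close>.\<close>
  have nL: "n * L + 4 * n + 2 \<le> D"
  proof -
    have "n * L \<le> n * (13 * n ^ 3)" using L13 by (rule mult_le_mono2)
    also have "\<dots> = 13 * n ^ 4" by (simp add: power4_eq_xxxx power3_eq_cube)
    also have "\<dots> \<le> 13 * n ^ 5" using n2 by (intro mult_le_mono2 power_increasing) auto
    finally have "n * L \<le> 13 * n ^ 5" .
    moreover have "n \<le> n ^ 5" using n2 by (intro self_le_power) auto
    moreover have "n ^ 5 \<ge> 1" using n2 by simp
    ultimately show ?thesis using D(1) by linarith
  qed
  have "M * (n * card Y + 2) = n * (M * card Y) + (4 * n + 2)" by (simp add: M_def algebra_simps)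
  also have "\<dots> \<le> n * (2 * D + L) + (4 * n + 2)" using bd by (intro add_right_mono mult_le_mono2)
  also have "\<dots> = 2 * n * D + (n * L + 4 * n + 2)" by (simp add: algebra_simps)
  also have "\<dots> \<le> 2 * n * D + D" using nL by (rule add_left_mono)
  also have "\<dots> = M * D" by (simp add: M_def)
  finally have "n * card Y + 2 \<le> D" by (rule mult_left_le_imp_le) (simp add: M_def)
  then show ?thesis by simp
qed

text \<open>Only \<open>2 * h\<close> elements of \<open>X\<close> enter. They yield at least
  \<open>2 * h\<^sup>2\<close> products of at most two nodes without squares, which permits
  vanishing order \<open>M = h\<^sup>2\<close>.\<close>

lemma large_factor_bound:
  fixes X Y :: "int set" and l :: int
  assumes p: "prime p" and X: "X \<subseteq> {1..<int p}" and Y: "Y \<subseteq> {0..<int p}" and l: "\<not> int p dvd l"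
    and XY: "\<And>a y. a \<in> X \<Longrightarrow> y \<in> Y \<Longrightarrow> [(a * y + l) ^ D = 1] (mod int p)"
    and n: "2 * h \<le> card X" and h: "h \<ge> 1" 
    and D: "40 * h ^ 5 \<le> D" "2 * D < p"
  shows "h\<^sup>2 * card Y \<le> 3 * D"
proof -
  obtain X' where X': "X' \<subseteq> X" "card X' = 2 * h" using n by (metis obtain_subset_with_card_n)
  \<comment> \<open>Makes \<open>L + 1 + 2 * h * h\<^sup>2\<close> equal to
    \<open>2 * L - 1\<close>, just below what half the number of products permits.\<close>
  define L where "L = 2 * h ^ 3 + 2"
  define s where "s = h * (2 * h + 1)"
  have h2: "1 \<le> h\<^sup>2" "h \<le> h\<^sup>2" "1 \<le> h ^ 3" using h by (simp_all add: power2_eq_square)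
  have s3: "s \<le> 3 * h\<^sup>2" "2 * h\<^sup>2 \<le> s" unfolding s_def using h2 by (simp_all add: power2_eq_square)
  have s: "2 * s = (2 * h + 1) * (2 * h + 2 * 0)" by (simp add: s_def)
  have M1: "h\<^sup>2 * (L + 1 + 2 * h * h\<^sup>2) < s * L"
  proof -
    have "h\<^sup>2 * (L + 1 + 2 * h * h\<^sup>2) < h\<^sup>2 * (2 * L)"
      using h by (intro mult_strict_left_mono) (simp_all add: L_def power2_eq_square power3_eq_cube)
    also have "\<dots> \<le> s * L" using mult_le_mono1[OF s3(2), of L] by (simp add: mult_ac)
    finally show ?thesis .
  qed
  have B: "(s + 1) * (L + s * (2 * h)) \<le> D"
  proof -
    have "s * (2 * h) \<le> 3 * h\<^sup>2 * (2 * h)" using s3(1) by (rule mult_le_mono1)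
    also have "\<dots> = 6 * h ^ 3" by (simp add: power2_eq_square power3_eq_cube)
    finally have "L + s * (2 * h) \<le> 10 * h ^ 3" unfolding L_def using h2 by linarith
    moreover have "s + 1 \<le> 4 * h\<^sup>2" using s3 h2 by linarith
    ultimately have "(s + 1) * (L + s * (2 * h)) \<le> (4 * h\<^sup>2) * (10 * h ^ 3)" by (intro mult_le_mono)
    also have "\<dots> = 40 * h ^ 5" by (simp add: power_add[symmetric])
    finally show ?thesis using D(1) by simp
  qed
  have "h\<^sup>2 * card Y \<le> 2 * D + L"
  proof (rule pair_bound[OF p _ Y l _ X'(2)[symmetric] _ s M1 B])
    show "(1 + 0) * D + (s + 1) * (L + s * (2 * h)) < p"
      using le_less_trans[OF add_left_mono[OF B, of D]] D(2) by (simp only: add_0_right mult_1 mult_2)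
  qed (use X X' XY in auto)
  moreover have "L \<le> D"
  proof -
    have "h ^ 3 \<le> h ^ 5" using h by (intro power_increasing) auto
    then show ?thesis unfolding L_def using D(1) h2 by linarith
  qed
  ultimately show ?thesis by linarith
qed

text \<open>All \<open>2 ^ k\<close> squarefree products are combined with 400 powers of the
  function \<open>x ^ p\<close>. The bound is \<open>p / 2 ^ k\<close> times about
  \<open>(399 + k / 2) / 400\<close>, close to the expected frequency of one pattern.\<close>

lemma sign_pattern_bound:
  fixes W Y :: "int set" and l :: int and \<sigma> :: "int \<Rightarrow> int"
  assumes p: "prime p" "p = 2 * D + 1" and D: "D \<ge> 10 ^ 16"
    and W: "W \<subseteq> {1..<int p}" "card W = k" "k \<le> 7" and l: "\<not> int p dvd l"
    and Y: "Y \<subseteq> {0..<int p}"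
    and WY: "\<And>w y. w \<in> W \<Longrightarrow> y \<in> Y \<Longrightarrow> [(w * y + l) ^ D = \<sigma> w] (mod int p)"
    and \<sigma>: "\<And>w. w \<in> W \<Longrightarrow> \<sigma> w = 1 \<or> \<sigma> w = -1"
    and s: "s = 2 ^ k * 400" and L: "L = s * (400 + k * s)"
  shows "(s - 1) * card Y \<le> k * D + L + p * 399"
proof -
  have s0: "s > 0" using s by simp
  have s1: "s \<le> 51200"
  proof -
    have "(2::nat) ^ k \<le> 2 ^ 7" using W(3) by (intro power_increasing) auto
    then show ?thesis using s by simp
  qed
  have "k * s \<le> 7 * 51200" using W(3) s1 by (rule mult_le_mono)
  have "L \<le> 51200 * (400 + 7 * 51200)"
    unfolding L using \<open>k * s \<le> 7 * 51200\<close> by (intro mult_le_mono[OF s1] add_left_mono)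
  moreover have "s * k \<le> 7 * 51200" using \<open>k * s \<le> 7 * 51200\<close> by (simp only: mult.commute)
  ultimately have "L + s * k \<le> 51200 * (400 + 7 * 51200) + 7 * 51200" by (rule add_le_mono)
  moreover have "s + 1 \<le> 51200 + 1" using s1 by simp
  ultimately have "(s + 1) * (L + s * k) \<le> (51200 + 1) * (51200 * (400 + 7 * 51200) + 7 * 51200)"
    by (intro mult_le_mono)
  also have "\<dots> \<le> D" using D by simp
  finally have B: "(s + 1) * (L + s * k) \<le> D" .
  have "(s - 1) * card Y \<le> k * D + L + p * (400 - 1)"
  proof (rule shifted_product_bound[where \<tau> = \<sigma> and E = "Pow {..<k}" and ex = "\<lambda>e i. if i \<in> e then 1 else 0"
        and K = 1 and s = s and n = k, OF p(1) _ _ _ Y l WY _ W(2)[symmetric]])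
    show "finite W" using W(1) by (rule finite_subset) simp
    show "\<not> int p dvd a" if "a \<in> W" for a using that W(1) zdvd_not_zless by auto
    show "\<not> int p dvd a - a'" if "a \<in> W" "a' \<in> W" "a \<noteq> a'" for a a'
    proof -
      have "0 \<le> a" "a < int p" "0 \<le> a'" "a' < int p" using that W(1) by auto
      then show ?thesis using that(3) by (metis mod_eq_dvd_iff mod_pos_pos_trivial)
    qed
    show "\<not> int p dvd \<sigma> w" if "w \<in> W" for w 
      using \<sigma>[OF that] p(1) by (auto simp: prime_nat_iff)
    show "s = card (Pow {..<k}) * 400" by (simp add: card_Pow s)
    show "e = e'" if "e \<in> Pow {..<k}" "e' \<in> Pow {..<k}"
      "\<And>i. i < k \<Longrightarrow> (if i \<in> e then 1 else 0::nat) = (if i \<in> e' then 1 else 0)" for e e'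
    proof (rule Set.set_eqI)
      fix i
      show "i \<in> e \<longleftrightarrow> i \<in> e'" using that(1,2) that(3)[of i] by (cases "i < k") (auto split: if_splits)
    qed
    show "(\<Sum>i<k. if i \<in> e then 1 else 0) \<le> k" for e
    proof -
      have "(\<Sum>i<k. if i \<in> e then 1 else 0::nat) \<le> (\<Sum>i<k. 1)" by (rule sum_mono) simp
      then show ?thesis by simp
    qed
    \<comment> \<open>The order \<open>s - 1\<close> is the largest below the number
      \<open>s\<close> of unknown coefficient polynomials, which keeps the main term sharp;
      \<open>L\<close> absorbs the remaining conditions.\<close>
    show "(s - 1) * (L + 400 + k * (s - 1)) < s * L"
    proof -
      have "(s - 1) * (400 + k * (s - 1)) \<le> (s - 1) * (400 + k * s)"
        by (intro mult_le_mono2 add_left_mono) simp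
      also have "\<dots> < L" unfolding L using s0 by (intro mult_strict_right_mono) auto
      finally have a: "(s - 1) * (400 + k * (s - 1)) < L" .
      have "(s - 1) * (L + 400 + k * (s - 1)) = (s - 1) * L + (s - 1) * (400 + k * (s - 1))"
        by (simp only: add.assoc distrib_left)
      also have "\<dots> < (s - 1) * L + L" using a by (rule add_strict_left_mono)
      also have "\<dots> = s * L" using s0 by (metis add.commute mult_eq_if less_numeral_extra(3))
      finally show ?thesis .
    qed
    have "D + (s + 1) * (L + s * k) \<le> D + D" using B by (rule add_left_mono)
    then show "1 * D + (s + 1) * (L + s * k) < p" unfolding p(2) mult_1 by linarith
  qed (use B in auto)
  then show ?thesis by simp
qed

lemma sign_pattern_arith:
  assumes k: "2 \<le> k" "k \<le> 7" and D: "D \<ge> (10::nat) ^ 16"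
    and s: "s = 2 ^ k * 400" and L: "L = s * (400 + k * s)"
    and le: "(s - 1) * (2 * D + 1) \<le> (s - 1) * k + (2 ^ k - 1) * (k * D + L + (2 * D + 1) * 399)"
  shows False
proof -
  consider "k = 2" | "k = 3" | "k = 4" | "k = 5" | "k = 6" | "k = 7" using k by linarith
  then show False
    using D le unfolding s L by cases simp_all
qed

text \<open>The sign pattern that is 1 at the quotient 1 and -1 at all others never occurs: a point
  \<open>y\<close> with it would be \<open>a * x\<close> with \<open>x\<close> in \<open>Y\<close>,
  and then \<open>(a' / a) * y = a' * x\<close> has sign 1 for another \<open>a'\<close> in
  \<open>A\<close>. The other patterns are too rare to cover all residues.\<close>

lemma index_two_small_factor:
  fixes A Y :: "int set" and l :: int
  assumes p: "prime p" "p = 2 * D + 1" and D: "D \<ge> 10 ^ 16"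
    and A: "A \<subseteq> {1..<int p}" "card A = 2 \<or> card A = 3" and l: "\<not> int p dvd l"
    and Y: "Y \<subseteq> {0..<int p}"
    and AY: "\<And>a y. a \<in> A \<Longrightarrow> y \<in> Y \<Longrightarrow> [(a * y + l) ^ D = 1] (mod int p)"
    and cover: "\<And>s. s \<in> {1..<int p} \<Longrightarrow> [(s + l) ^ D = 1] (mod int p) \<Longrightarrow> \<exists>a\<in>A. \<exists>y\<in>Y. [s = a * y] (mod int p)"
  shows False
proof -
  have pr: "prime (int p)" using p(1) by simp
  have p3: "int p > 2" using p(2) D by simp
  have neq: "\<not> [1 = -1] (mod int p)"
    using p3 by (auto simp: cong_iff_dvd_diff dest: zdvd_imp_le)
  have finA: "finite A" using A(1) by (rule finite_subset) simp
  have An: "\<not> int p dvd a" if "a \<in> A" for a using that A(1) zdvd_not_zless by auto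
  define iv where "iv a = (SOME b. [a * b = 1] (mod int p))" for a
  have iv: "[a * iv a = 1] (mod int p)" if "a \<in> A" for a
    unfolding iv_def by (rule someI_ex[OF int_inverse_mod[OF p(1) An[OF that]]])
  define w where "w a a' = (a' * iv a) mod int p" for a a'
  have w: "[w a a' * a = a'] (mod int p)" if "a \<in> A" for a a'
  proof -
    have "[w a a' * a = a' * iv a * a] (mod int p)" unfolding w_def by (intro cong_scalar_right) (simp add: cong_def)
    also have "a' * iv a * a = a' * (a * iv a)" by simp
    also have "[a' * (a * iv a) = a' * 1] (mod int p)" by (intro cong_scalar_left iv that)
    finally show ?thesis by simp
  qed
  have w1: "w a a = 1" if "a \<in> A" for a
    using iv[OF that] p3 by (simp add: w_def cong_def)
  have wn1: "w a a' \<noteq> 1" if "a \<in> A" "a' \<in> A" "a \<noteq> a'" for a a'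
  proof
    assume "w a a' = 1"
    with w[OF that(1), of a'] have "[a = a'] (mod int p)" by simp
    moreover have "0 \<le> a" "a < int p" "0 \<le> a'" "a' < int p" using that A(1) by auto
    ultimately show False using that(3) by (simp add: cong_def)
  qed
  define W where "W = (\<lambda>(a, a'). w a a') ` (A \<times> A)"
  have W: "W \<subseteq> {1..<int p}"
  proof
    fix v assume "v \<in> W"
    then obtain a a' where a: "a \<in> A" "a' \<in> A" "v = w a a'" unfolding W_def by auto
    have "0 \<le> v" "v < int p" using p3 by (auto simp: a(3) w_def)
    moreover have "v \<noteq> 0"
    proof
      assume "v = 0"
      with w[OF a(1), of a'] a(3) have "int p dvd a'" by (simp add: cong_def mod_0_imp_dvd)
      with An[OF a(2)] show False by simp
    qed
    ultimately show "v \<in> {1..<int p}" by auto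
  qed
  have finW: "finite W" unfolding W_def using finA by auto
  obtain a1 a2 where a12: "a1 \<in> A" "a2 \<in> A" "a1 \<noteq> a2"
    using A(2) by (metis card_le_Suc0_iff_eq finA numeral_2_eq_2 numeral_3_eq_3 Suc_n_not_le_n le_SucI not_less_eq_eq)
  define k where "k = card W"
  have k2: "2 \<le> k"
  proof -
    have "{1, w a1 a2} \<subseteq> W" using a12 w1[of a1] unfolding W_def by force
    then have "card {1, w a1 a2} \<le> k" unfolding k_def using finW by (intro card_mono)
    then show ?thesis using wn1[OF a12] by simp
  qed
  \<comment> \<open>The diagonal quotients all equal 1, leaving at most \<open>3 * 3 - 3 + 1\<close>
    elements.\<close>
  have k7: "k \<le> 7"
  proof -
    let ?O = "A \<times> A - (\<lambda>a. (a, a)) ` A"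
    have "W \<subseteq> insert 1 ((\<lambda>(a, a'). w a a') ` ?O)"
      unfolding W_def using w1 by force
    then have "k \<le> card (insert 1 ((\<lambda>(a, a'). w a a') ` ?O))"
      unfolding k_def using finA by (intro card_mono) auto
    also have "\<dots> \<le> Suc (card ((\<lambda>(a, a'). w a a') ` ?O))" by (simp add: card_insert_if finA)
    also have "\<dots> \<le> Suc (card ?O)" using finA by (simp add: card_image_le)
    also have "card ?O = card A * card A - card A"
      using finA by (subst card_Diff_subset) (auto simp: card_image inj_on_def card_cartesian_product)
    finally show ?thesis using A(2) by auto
  qed
  define s where "s = 2 ^ k * (400::nat)"
  define L where "L = s * (400 + k * s)"
  define \<Sigma> where "\<Sigma> = W \<rightarrow>\<^sub>E {1, -1::int}"
  define \<sigma>0 where "\<sigma>0 = restrict (\<lambda>v. if v = 1 then 1 else -1::int) W"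
  define Z where "Z \<sigma> = {y \<in> {0..<int p}. \<forall>v\<in>W. [(v * y + l) ^ D = \<sigma> v] (mod int p)}" for \<sigma>
  \<comment> \<open>Points at which some linear form vanishes, so that no sign is defined; each form
    contributes at most one.\<close>
  define Nd where "Nd = (\<Union>v\<in>W. {y \<in> {0..<int p}. int p dvd v * y + l})"
  have fin\<Sigma>: "finite \<Sigma>" unfolding \<Sigma>_def using finW by (intro finite_PiE) auto
  have c\<Sigma>: "card \<Sigma> = 2 ^ k" unfolding \<Sigma>_def k_def using finW by (simp add: card_PiE numeral_2_eq_2)
  have \<sigma>0: "\<sigma>0 \<in> \<Sigma>" unfolding \<sigma>0_def \<Sigma>_def by auto
  have 1: "1 \<in> W" using a12(1) w1[of a1] unfolding W_def by force
  have empty: "Z \<sigma>0 = {}"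
  proof (rule ccontr)
    assume "Z \<sigma>0 \<noteq> {}"
    then obtain y where y: "y \<in> {0..<int p}" "\<And>v. v \<in> W \<Longrightarrow> [(v * y + l) ^ D = \<sigma>0 v] (mod int p)"
      unfolding Z_def by auto
    have y1: "[(y + l) ^ D = 1] (mod int p)" using y(2)[OF 1] 1 by (simp add: \<sigma>0_def)
    have v: "\<not> [(v * y + l) ^ D = 1] (mod int p)" if "v \<in> W" "v \<noteq> 1" for v
    proof
      assume "[(v * y + l) ^ D = 1] (mod int p)"
      moreover have "[(v * y + l) ^ D = -1] (mod int p)" using y(2)[OF that(1)] that by (simp add: \<sigma>0_def)
      ultimately show False using neq by (metis cong_sym cong_trans)
    qed
    have W12: "w a1 a2 \<in> W" using a12 unfolding W_def by force
    \<comment> \<open>At 0 all linear forms take the value \<open>l\<close>, so two different signs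
      are impossible.\<close>
    have "y \<noteq> 0"
    proof
      assume "y = 0"
      with y1 v[OF W12 wn1[OF a12]] show False by simp
    qed
    with y(1) have "y \<in> {1..<int p}" by auto
    with cover y1 obtain a x where ax: "a \<in> A" "x \<in> Y" "[y = a * x] (mod int p)" by blast
    obtain a' where a': "a' \<in> A" "a' \<noteq> a" using a12 by metis
    have "[w a a' * y + l = w a a' * (a * x) + l] (mod int p)"
      by (intro cong_add cong_scalar_left ax(3) cong_refl)
    also have "w a a' * (a * x) + l = w a a' * a * x + l" by simp
    also have "[w a a' * a * x + l = a' * x + l] (mod int p)"
      by (intro cong_add cong_scalar_right w ax(1) cong_refl)
    finally have "[(w a a' * y + l) ^ D = (a' * x + l) ^ D] (mod int p)" by (rule cong_pow)
    with AY[OF a'(1) ax(2)] have "[(w a a' * y + l) ^ D = 1] (mod int p)" by (metis cong_trans)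
    moreover have "w a a' \<in> W" using ax(1) a' unfolding W_def by force
    ultimately show False using v wn1[OF ax(1) a'(1)] a'(2) by auto
  qed
  have "{0..<int p} \<subseteq> Nd \<union> (\<Union>\<sigma>\<in>\<Sigma> - {\<sigma>0}. Z \<sigma>)"
  proof
    fix y assume y: "y \<in> {0..<int p}"
    show "y \<in> Nd \<union> (\<Union>\<sigma>\<in>\<Sigma> - {\<sigma>0}. Z \<sigma>)"
    proof (cases "y \<in> Nd")
      case False
      have pm: "[(v * y + l) ^ D = 1] (mod int p) \<or> [(v * y + l) ^ D = -1] (mod int p)" if "v \<in> W" for v
      proof -
        let ?x = "v * y + l"
        have nd: "\<not> int p dvd ?x" using False y that unfolding Nd_def by auto
        have "[?x ^ p = ?x] (mod int p)" by (rule int_fermat[OF p(1)])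
        then have "int p dvd ?x ^ p - ?x" by (simp add: cong_iff_dvd_diff)
        \<comment> \<open>Euler's criterion from Fermat's theorem: with \<open>p = 2 * D + 1\<close>
          the difference factors.\<close>
        also have "?x ^ p - ?x = ?x * ((?x ^ D - 1) * (?x ^ D - (-1)))"
        proof -
          have "x ^ (2 * D + 1) - x = x * ((x ^ D - 1) * (x ^ D - (-1)))" for x :: int
          proof -
            have "x ^ (2 * D + 1) = x ^ D * x ^ D * x" by (simp only: mult_2 power_add power_one_right)
            then show ?thesis by (simp add: algebra_simps)
          qed
          then show ?thesis unfolding p(2) .
        qed
        finally have "int p dvd ?x ^ D - 1 \<or> int p dvd ?x ^ D - (-1)"
          using nd by (simp add: prime_dvd_mult_iff[OF pr])
        then show ?thesis by (simp add: cong_iff_dvd_diff)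
      qed
      define \<sigma> where "\<sigma> = restrict (\<lambda>v. if [(v * y + l) ^ D = 1] (mod int p) then 1 else -1::int) W"
      have "\<sigma> \<in> \<Sigma>" unfolding \<sigma>_def \<Sigma>_def by auto
      moreover have "y \<in> Z \<sigma>" unfolding Z_def \<sigma>_def using y pm by auto
      ultimately show ?thesis using empty by auto
    qed simp
  qed
  moreover have "Nd \<union> (\<Union>\<sigma>\<in>\<Sigma> - {\<sigma>0}. Z \<sigma>) \<subseteq> {0..<int p}" by (auto simp: Nd_def Z_def)
  then have "finite (Nd \<union> (\<Union>\<sigma>\<in>\<Sigma> - {\<sigma>0}. Z \<sigma>))" by (rule finite_subset) simp
  ultimately have "card {0..<int p} \<le> card (Nd \<union> (\<Union>\<sigma>\<in>\<Sigma> - {\<sigma>0}. Z \<sigma>))"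
    by (intro card_mono)
  also have "\<dots> \<le> card Nd + card (\<Union>\<sigma>\<in>\<Sigma> - {\<sigma>0}. Z \<sigma>)" by (rule card_Un_le)
  also have "card (\<Union>\<sigma>\<in>\<Sigma> - {\<sigma>0}. Z \<sigma>) \<le> (\<Sum>\<sigma>\<in>\<Sigma> - {\<sigma>0}. card (Z \<sigma>))"
    using fin\<Sigma> by (intro card_UN_le) auto
  also have "card Nd \<le> k"
  proof -
    have "card Nd \<le> (\<Sum>v\<in>W. card {y \<in> {0..<int p}. int p dvd v * y + l})"
      unfolding Nd_def using finW by (rule card_UN_le)
    also have "\<dots> \<le> (\<Sum>v\<in>W. 1)"
    proof (rule sum_mono)
      fix v assume v: "v \<in> W"
      have "y = y'" if "y \<in> {0..<int p}" "int p dvd v * y + l" "y' \<in> {0..<int p}" "int p dvd v * y' + l" for y y'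
      proof -
        have "int p dvd v * (y - y')" using dvd_diff[OF that(2,4)] by (simp add: algebra_simps)
        moreover have "\<not> int p dvd v" using v W zdvd_not_zless by auto
        ultimately have "int p dvd y - y'" by (simp add: prime_dvd_mult_iff[OF pr])
        then have "y mod int p = y' mod int p" by (simp add: mod_eq_dvd_iff)
        then show ?thesis using that by simp
      qed
      moreover have "finite {y \<in> {0..<int p}. int p dvd v * y + l}" by (rule finite_subset[of _ "{0..<int p}"]) auto
      ultimately show "card {y \<in> {0..<int p}. int p dvd v * y + l} \<le> 1"
        unfolding One_nat_def by (subst card_le_Suc0_iff_eq) blast+
    qed
    finally show ?thesis by (simp add: k_def)
  qed
  finally have "p \<le> k + (\<Sum>\<sigma>\<in>\<Sigma> - {\<sigma>0}. card (Z \<sigma>))" by simp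
  then have "(s - 1) * p \<le> (s - 1) * (k + (\<Sum>\<sigma>\<in>\<Sigma> - {\<sigma>0}. card (Z \<sigma>)))" by (rule mult_le_mono2)
  also have "\<dots> = (s - 1) * k + (\<Sum>\<sigma>\<in>\<Sigma> - {\<sigma>0}. (s - 1) * card (Z \<sigma>))"
    by (simp add: distrib_left sum_distrib_left)
  also have "\<dots> \<le> (s - 1) * k + (\<Sum>\<sigma>\<in>\<Sigma> - {\<sigma>0}. k * D + L + p * 399)"
  proof (intro add_left_mono sum_mono)
    fix \<sigma> assume "\<sigma> \<in> \<Sigma> - {\<sigma>0}"
    then have pm: "\<sigma> v = 1 \<or> \<sigma> v = -1" if "v \<in> W" for v using that unfolding \<Sigma>_def by auto
    show "(s - 1) * card (Z \<sigma>) \<le> k * D + L + p * 399"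
      by (rule sign_pattern_bound[OF p D W k_def[symmetric] k7 l _ _ pm s_def L_def])
        (auto simp: Z_def)
  qed
  also have "\<dots> = (s - 1) * k + (2 ^ k - 1) * (k * D + L + p * 399)"
    using \<sigma>0 fin\<Sigma> by (simp add: c\<Sigma>)
  finally have "(s - 1) * (2 * D + 1) \<le> (s - 1) * k + (2 ^ k - 1) * (k * D + L + (2 * D + 1) * 399)"
    unfolding p(2) .
  with sign_pattern_arith[OF k2 k7 D s_def L_def] show False .
qed

section \<open>Ternary decompositions\<close>

lemma card_power_eq_one_mod:
  assumes p: "prime p" and D: "D > 0"
  shows "card {g \<in> {1..<int p}. [g ^ D = 1] (mod int p)} \<le> D"
proof -
  interpret poly_mod_prime p by standard (rule p)
  let ?R = "{g \<in> {1..<int p}. [g ^ D = 1] (mod int p)}" and ?f = "monom (1::int) D - 1"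
  have deg: "degree ?f = D"
  proof -
    have "degree (monom (1::int) D + (- 1)) = degree (monom (1::int) D)"
      using D by (intro degree_add_eq_left) (simp add: degree_monom_eq)
    then show ?thesis by (simp add: degree_monom_eq)
  qed
  have "1 * card ?R \<le> degree ?f"
  proof (rule card_roots_mod)
    have "lead_coeff ?f = 1" using D by (simp add: deg)
    then show "\<not> P dvd ?f" by (rule not_P_dvd_monic)
    fix y assume y: "y \<in> ?R"
    then have "int p dvd poly ?f y" by (simp add: poly_monom cong_iff_dvd_diff)
    then obtain h where "P dvd ?f - [:-y, 1:] * h" by (rule linear_dvd_mod)
    then show "\<exists>h. P dvd ?f - [:-y, 1:] ^ 1 * h" by auto
    fix y' assume y': "y' \<in> ?R" "y \<noteq> y'"
    have "0 \<le> y" "y < int p" "0 \<le> y'" "y' < int p" using y y' by auto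
    then show "\<not> int p dvd y - y'" using y'(2) by (metis mod_eq_dvd_iff mod_pos_pos_trivial)
  qed (rule finite_subset[of _ "{1..<int p}"], auto)
  then show ?thesis by (simp add: deg)
qed

text \<open>If \<open>X\<close> has at least \<open>2 * h\<close> elements,
  \<open>large_factor_bound\<close> applies. A smaller \<open>X\<close> is impossible: either
  \<open>small_factor_bound\<close> contradicts \<open>large\<close>, or the index is two with 2 or
  3 elements and \<open>index_two_small_factor\<close> applies.\<close>

lemma factor_bound:
  fixes X Z :: "int set" and l :: int
  assumes p: "prime p" "k * D = p - 1" "k \<ge> 2" and D: "10 ^ 16 \<le> D" "1440 * h ^ 5 \<le> D" and h: "h \<ge> 1"
    and l: "\<not> int p dvd l" and X: "X \<subseteq> {1..<int p}" "card X \<ge> 2" and Z: "Z \<subseteq> {0..<int p}"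
    and XZ: "\<And>a y. a \<in> X \<Longrightarrow> y \<in> Z \<Longrightarrow> [(a * y + l) ^ D = 1] (mod int p)"
    and cover: "\<And>s. s \<in> {1..<int p} \<Longrightarrow> [(s + l) ^ D = 1] (mod int p) \<Longrightarrow> \<exists>a\<in>X. \<exists>y\<in>Z. [s = a * y] (mod int p)"
    and large: "D \<le> card X * card Z + 1"
  shows "h\<^sup>2 * card Z \<le> 3 * D"
proof -
  have p0: "p = k * D + 1" using p(1,2) prime_gt_0_nat[of p] by simp
  have kD: "m * D < p" if "m \<le> k" for m unfolding p0 using that by (simp add: le_imp_less_Suc)
  show ?thesis
  proof (cases "2 * h \<le> card X")
    case True
    show ?thesis
      using large_factor_bound[OF p(1) X(1) Z l XZ True h _ kD[OF p(3)]] D(2) by simp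
  next
    case False
    \<comment> \<open>Here \<open>1440 = 45 * 2 ^ 5\<close> matches the size condition of
      \<open>small_factor_bound\<close>.\<close>
    have n5: "45 * card X ^ 5 \<le> D"
    proof -
      have "card X ^ 5 \<le> (2 * h) ^ 5" using False by (intro power_mono) auto
      then have "45 * card X ^ 5 \<le> 45 * (2 * h) ^ 5" by simp
      also have "\<dots> = 1440 * h ^ 5" by (simp add: power_mult_distrib)
      finally show ?thesis using D(2) by simp
    qed
    have False
    proof (cases "k \<ge> 3 \<or> card X \<ge> 4")
      case True
      \<comment> \<open>Squares of nodes need \<open>3 * D < p\<close>, that is, index at least
        three.\<close>
      define u where "u = (if k \<ge> 3 then 1 else 0 :: nat)"
      have "u \<le> 1" "u = 1 \<or> card X \<ge> 4" "2 + u \<le> k" using True p(3) by (auto simp: u_def)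
      then have "card X * card Z + 1 < D"
        by (intro small_factor_bound[OF p(1) X(1) Z l XZ refl _ X(2) _ n5 kD]) auto
      with large show False by simp
    next
      case False
      then have "p = 2 * D + 1" "card X = 2 \<or> card X = 3" using p(3) X(2) p0 by auto
      then show False using index_two_small_factor[OF p(1) _ D(1) X(1) _ l Z XZ cover] by blast
    qed
    then show ?thesis ..
  qed
qed

text \<open>Each pairwise product set has at most \<open>3 * D / h\<^sup>2\<close> elements, so the
  triple product inequality gives \<open>h ^ 6 \<le> 108 * D\<close>, whereas \<open>D\<close> is
  only of order \<open>h ^ 5\<close> for the maximal \<open>h\<close>.\<close>

lemma no_ternary_product:
  fixes A B C :: "int set" and l :: int
  assumes p: "prime p" "k * D = p - 1" "k \<ge> 2" and D: "1440 * (5 * 10 ^ 6) ^ 5 \<le> D"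
    and l: "\<not> int p dvd l"
    and A: "A \<subseteq> {1..<int p}" "card A \<ge> 2" and B: "B \<subseteq> {1..<int p}" "card B \<ge> 2"
    and C: "C \<subseteq> {1..<int p}" "card C \<ge> 2"
    and S: "(\<lambda>(a, b, c). a * b * c mod int p) ` (A \<times> B \<times> C) =
      {s \<in> {1..<int p}. [(s + l) ^ D = 1] (mod int p)}"
    and cS: "D \<le> card {s \<in> {1..<int p}. [(s + l) ^ D = 1] (mod int p)} + 1"
  shows False
proof -
  let ?F = "\<lambda>(a, b, c). a * b * c mod int p" and ?S = "{s \<in> {1..<int p}. [(s + l) ^ D = 1] (mod int p)}"
  have p0: "int p > 0" using p(1) prime_gt_0_nat by simp
  \<comment> \<open>Exceeds \<open>108 * 1440 * 2 ^ 5 = 4976640\<close>, the constant reached in the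
    final comparison.\<close>
  define H where "H = (5 * 10 ^ 6 :: nat)"
  define h where "h = (GREATEST h. 1440 * h ^ 5 \<le> D)"
  have bd: "x \<le> D" if "1440 * x ^ 5 \<le> D" for x
  proof -
    have "x \<le> x ^ 5" by (cases "x = 0") (auto intro!: self_le_power)
    then show ?thesis using that by linarith
  qed
  have HD: "1440 * H ^ 5 \<le> D" using D by (simp only: H_def)
  have hD: "1440 * h ^ 5 \<le> D" unfolding h_def
    by (rule GreatestI_nat[where k = H and b = D]) (use HD bd in blast)+
  have hH: "H \<le> h" unfolding h_def
    by (rule Greatest_le_nat[where b = D]) (use HD bd in blast)+
  have Dh: "D < 1440 * (h + 1) ^ 5"
  proof (rule ccontr)
    assume "\<not> ?thesis"
    then have "1440 * (h + 1) ^ 5 \<le> D" by simp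
    then have "h + 1 \<le> (GREATEST h. 1440 * h ^ 5 \<le> D)" by (rule Greatest_le_nat[where b = D]) (use bd in blast)
    then have "h + 1 \<le> h" by (simp only: h_def[symmetric])
    then show False by simp
  qed
  have h1: "h \<ge> 1" using hH by (simp add: H_def)
  have D16: "10 ^ 16 \<le> D" using D by (rule order_trans[rotated]) simp
  have fin: "finite A" "finite B" "finite C" using A(1) B(1) C(1) finite_subset by blast+
  let ?AB = "(\<lambda>(a, b). a * b mod int p) ` (A \<times> B)"
  let ?BC = "(\<lambda>(b, c). b * c mod int p) ` (B \<times> C)"
  let ?AC = "(\<lambda>(a, c). a * c mod int p) ` (A \<times> C)"
  have ruzsa: "(card (?F ` (A \<times> B \<times> C)))\<^sup>2 \<le> card ?AB * card ?BC * card ?AC"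
  proof (rule card_triple_product[OF fin])
    fix a a' b b' c c' :: int
    show "a * b mod int p = a' * b' mod int p \<Longrightarrow> a * b * c mod int p = a' * b' * c mod int p"
      by (metis mod_mult_left_eq)
    show "b * c mod int p = b' * c' mod int p \<Longrightarrow> a * b * c mod int p = a * b' * c' mod int p"
      by (metis mod_mult_right_eq mult.assoc)
    show "a * c mod int p = a' * c' mod int p \<Longrightarrow> a * b * c mod int p = a' * b * c' mod int p"
      by (metis mod_mult_left_eq mult.assoc mult.commute)
  qed
  have mem: "[(a * b * c + l) ^ D = 1] (mod int p)" if "a \<in> A" "b \<in> B" "c \<in> C" for a b c
  proof -
    have "?F (a, b, c) \<in> ?S" unfolding S[symmetric] using that by blast
    then have "[(a * b * c mod int p + l) ^ D = 1] (mod int p)" by simp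
    moreover have "[(a * b * c mod int p + l) ^ D = (a * b * c + l) ^ D] (mod int p)"
      by (intro cong_pow cong_add) (simp_all add: cong_def)
    ultimately show ?thesis by (metis cong_sym cong_trans)
  qed
  \<comment> \<open>Stated for any splitting of the triple product as \<open>X\<close> times
    \<open>Z\<close>, so that each of \<open>A\<close>, \<open>B\<close>, \<open>C\<close> can serve
    as the single factor.\<close>
  have key: "h\<^sup>2 * card Z \<le> 3 * D"
    if X: "X \<subseteq> {1..<int p}" "card X \<ge> 2" and Z: "Z \<subseteq> {0..<int p}"
      and mem': "\<And>x z. x \<in> X \<Longrightarrow> z \<in> Z \<Longrightarrow> \<exists>a\<in>A. \<exists>b\<in>B. \<exists>c\<in>C. [x * z = a * b * c] (mod int p)"
      and cov: "\<And>a b c. a \<in> A \<Longrightarrow> b \<in> B \<Longrightarrow> c \<in> C \<Longrightarrow> \<exists>x\<in>X. \<exists>z\<in>Z. [a * b * c = x * z] (mod int p)"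
    for X Z
  proof (rule factor_bound[OF p D16 hD h1 l X Z])
    have cov': "\<exists>x\<in>X. \<exists>z\<in>Z. [s = x * z] (mod int p)" if "s \<in> ?S" for s
    proof -
      from that obtain a b c where "a \<in> A" "b \<in> B" "c \<in> C" "s = a * b * c mod int p"
        unfolding S[symmetric] by auto
      then show ?thesis using cov[of a b c] by (auto simp: cong_def)
    qed
    then show "\<exists>x\<in>X. \<exists>z\<in>Z. [s = x * z] (mod int p)"
      if "s \<in> {1..<int p}" "[(s + l) ^ D = 1] (mod int p)" for s using that by blast
    show "[(x * z + l) ^ D = 1] (mod int p)" if xz: "x \<in> X" "z \<in> Z" for x z
    proof -
      from mem'[OF xz] obtain a b c where abc: "a \<in> A" "b \<in> B" "c \<in> C" "[x * z = a * b * c] (mod int p)" by blast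
      then have "[(x * z + l) ^ D = (a * b * c + l) ^ D] (mod int p)"
        by (intro cong_pow cong_add cong_refl)
      with mem[OF abc(1-3)] show ?thesis by (metis cong_trans)
    qed
    have finX: "finite X" "finite Z" using X(1) Z finite_subset by blast+
    have "?S \<subseteq> (\<lambda>(x, z). x * z mod int p) ` (X \<times> Z)"
    proof
      fix s assume s: "s \<in> ?S"
      then obtain x z where xz: "x \<in> X" "z \<in> Z" "[s = x * z] (mod int p)" using cov' by blast
      then have "s = x * z mod int p" using s by (simp add: cong_def)
      with xz show "s \<in> (\<lambda>(x, z). x * z mod int p) ` (X \<times> Z)" by (auto intro: image_eqI[of _ _ "(x, z)"])
    qed
    then have "card ?S \<le> card ((\<lambda>(x, z). x * z mod int p) ` (X \<times> Z))"
      using finX by (intro card_mono) auto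
    also have "\<dots> \<le> card X * card Z"
      using finX by (metis card_cartesian_product card_image_le finite_cartesian_product)
    finally show "D \<le> card X * card Z + 1" using cS by simp
  qed
  have mm: "[x * (y mod int p) = x * y] (mod int p)" for x y by (simp add: cong_def mod_mult_right_eq)
  have BC: "h\<^sup>2 * card ?BC \<le> 3 * D"
  proof (rule key[OF A])
    show "?BC \<subseteq> {0..<int p}" using p0 by auto
    show "\<exists>a\<in>A. \<exists>b\<in>B. \<exists>c\<in>C. [x * z = a * b * c] (mod int p)" if "x \<in> A" "z \<in> ?BC" for x z
      using that mm[of x] by (auto simp: mult.assoc)
    show "\<exists>x\<in>A. \<exists>z\<in>?BC. [a * b * c = x * z] (mod int p)" if "a \<in> A" "b \<in> B" "c \<in> C" for a b c
      using that mm[of a "b * c", THEN cong_sym] by (auto simp: mult.assoc)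
  qed
  have AC: "h\<^sup>2 * card ?AC \<le> 3 * D"
  proof (rule key[OF B])
    show "?AC \<subseteq> {0..<int p}" using p0 by auto
    show "\<exists>a\<in>A. \<exists>b\<in>B. \<exists>c\<in>C. [x * z = a * b * c] (mod int p)" if "x \<in> B" "z \<in> ?AC" for x z
    proof -
      from that(2) obtain a c where z: "a \<in> A" "c \<in> C" "z = a * c mod int p" by auto
      have "x * (a * c) = a * x * c" by (simp add: mult_ac)
      then have "[x * z = a * x * c] (mod int p)" using mm[of x "a * c"] z(3) by (simp only:)
      with z(1,2) that(1) show ?thesis by blast
    qed
    show "\<exists>x\<in>B. \<exists>z\<in>?AC. [a * b * c = x * z] (mod int p)" if "a \<in> A" "b \<in> B" "c \<in> C" for a b c
    proof (rule bexI[of _ b], rule bexI[of _ "a * c mod int p"])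
      have "b * (a * c) = a * b * c" by (simp add: mult_ac)
      then show "[a * b * c = b * (a * c mod int p)] (mod int p)" using mm[of b "a * c", THEN cong_sym] by (simp only:)
    qed (use that in auto)
  qed
  have AB: "h\<^sup>2 * card ?AB \<le> 3 * D"
  proof (rule key[OF C])
    show "?AB \<subseteq> {0..<int p}" using p0 by auto
    show "\<exists>a\<in>A. \<exists>b\<in>B. \<exists>c\<in>C. [x * z = a * b * c] (mod int p)" if "x \<in> C" "z \<in> ?AB" for x z
    proof -
      from that(2) obtain a b where z: "a \<in> A" "b \<in> B" "z = a * b mod int p" by auto
      have "x * (a * b) = a * b * x" by (simp add: mult_ac)
      then have "[x * z = a * b * x] (mod int p)" using mm[of x "a * b"] z(3) by (simp only:)
      with z(1,2) that(1) show ?thesis by blast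
    qed
    show "\<exists>x\<in>C. \<exists>z\<in>?AB. [a * b * c = x * z] (mod int p)" if "a \<in> A" "b \<in> B" "c \<in> C" for a b c
    proof (rule bexI[of _ c], rule bexI[of _ "a * b mod int p"])
      have "c * (a * b) = a * b * c" by (simp add: mult_ac)
      then show "[a * b * c = c * (a * b mod int p)] (mod int p)" using mm[of c "a * b", THEN cong_sym] by (simp only:)
    qed (use that in auto)
  qed
  define N where "N = card ?S"
  have N2: "D \<le> 2 * N" using cS D16 unfolding N_def by simp
  have "h ^ 6 * D\<^sup>2 \<le> h ^ 6 * (2 * N)\<^sup>2" using N2 by (intro mult_le_mono2 power_mono) auto
  also have "\<dots> = 4 * (h ^ 6 * N\<^sup>2)" by (simp add: power_mult_distrib)
  also have "\<dots> \<le> 4 * (h ^ 6 * (card ?AB * card ?BC * card ?AC))"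
    using ruzsa unfolding S N_def by (intro mult_le_mono2)
  also have "\<dots> = 4 * ((h\<^sup>2 * card ?AB) * (h\<^sup>2 * card ?BC) * (h\<^sup>2 * card ?AC))"
  proof -
    have "h ^ 6 * (x * y * z) = (h\<^sup>2 * x) * (h\<^sup>2 * y) * (h\<^sup>2 * z)" for x y z :: nat
      by (simp add: eval_nat_numeral)
    then show ?thesis by simp
  qed
  also have "\<dots> \<le> 4 * ((3 * D) * (3 * D) * (3 * D))" by (intro mult_le_mono2 mult_le_mono AB BC AC)
  also have "\<dots> = 108 * D * D\<^sup>2" by (simp add: power2_eq_square)
  \<comment> \<open>\<open>108 = 4 * 3 ^ 3\<close>: the 4 comes from \<open>D \<le> 2 * N\<close>,
    the cube from the three pairwise bounds.\<close>
  finally have "h ^ 6 \<le> 108 * D" using D16 by (simp add: mult_le_cancel2)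
  also have "\<dots> < 108 * (1440 * (h + 1) ^ 5)" using Dh by simp
  also have "\<dots> \<le> 108 * (1440 * (2 * h) ^ 5)" using h1 by (intro mult_le_mono2 power_mono) auto
  also have "\<dots> = 4976640 * h ^ 5" by (simp add: power_mult_distrib)
  finally have "h ^ 6 < 4976640 * h ^ 5" .
  moreover have "h ^ 6 = h * h ^ 5" using power_Suc[of h 5] by simp
  ultimately have "h < 4976640" using mult_less_cancel2[of h "h ^ 5" 4976640] by simp
  with hH show False by (simp add: H_def)
qed

theorem theorem6p6:
  shows "\<exists>M::real. M > 0 \<and>
    (\<forall>(p::nat) G l.
       prime p \<longrightarrow>
       subgroup G (Fp_star p) \<longrightarrow>
       G \<noteq> carrier (Fp_star p) \<longrightarrow>
       real (card G) > M \<longrightarrow>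
       l \<in> carrier (Fp_star p) \<longrightarrow>
       \<not> (\<exists>A B C.
            A \<subseteq> carrier (Fp_star p) \<and>
            B \<subseteq> carrier (Fp_star p) \<and>
            C \<subseteq> carrier (Fp_star p) \<and>
            card A \<ge> 2 \<and> card B \<ge> 2 \<and> card C \<ge> 2 \<and>
            prod_set3 p A B C = shift_set p G l - {\<zero>\<^bsub>Fp p\<^esub>}))"
proof (intro exI[of _ "1440 * (5 * 10 ^ 6) ^ 5"] conjI allI impI notI)
  fix p :: nat and G :: "int set" and l :: int
  assume p: "prime p" and G: "subgroup G (Fp_star p)" and proper: "G \<noteq> carrier (Fp_star p)"
    and large: "1440 * (5 * 10 ^ 6) ^ 5 < real (card G)" and l: "l \<in> carrier (Fp_star p)"
    and "\<exists>A B C.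
            A \<subseteq> carrier (Fp_star p) \<and>
            B \<subseteq> carrier (Fp_star p) \<and>
            C \<subseteq> carrier (Fp_star p) \<and>
            card A \<ge> 2 \<and> card B \<ge> 2 \<and> card C \<ge> 2 \<and>
            prod_set3 p A B C = shift_set p G l - {\<zero>\<^bsub>Fp p\<^esub>}"
  then obtain A B C where ABC: "A \<subseteq> carrier (Fp_star p)" "B \<subseteq> carrier (Fp_star p)" "C \<subseteq> carrier (Fp_star p)"
    "card A \<ge> 2" "card B \<ge> 2" "card C \<ge> 2"
    and eq: "prod_set3 p A B C = shift_set p G l - {\<zero>\<^bsub>Fp p\<^esub>}" by blast
  interpret residues_prime p "Fp p" by (unfold_locales) (use p in auto)
  have p2: "int p > 1" using p prime_gt_1_nat by auto
  have car: "carrier (Fp_star p) = {1..<int p}" by (auto simp: residue_ring_def)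
  interpret grp: group "Fp_star p" by (rule field_mult_group)
  define D where "D = card G"
  have GD: "real D > 1440 * (5 * 10 ^ 6) ^ 5" using large by (simp add: D_def)
  have D0: "1440 * (5 * 10 ^ 6) ^ 5 \<le> D"
  proof -
    have "real (1440 * (5 * 10 ^ 6) ^ 5) \<le> real D" using GD by simp
    then show ?thesis by (simp only: of_nat_le_iff)
  qed
  have Gc: "G \<subseteq> {1..<int p}" using subgroup.subset[OF G] car by simp
  have ord: "Coset.order (Fp_star p) = p - 1" unfolding Coset.order_def car by simp
  define k where "k = card (rcosets\<^bsub>Fp_star p\<^esub> G)"
  have k: "k * D = p - 1" using grp.lagrange[OF G] by (simp add: k_def D_def ord)
  have k2: "k \<ge> 2"
  proof (rule ccontr)
    assume "\<not> k \<ge> 2"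
    moreover have "k \<noteq> 0" using k p2 by (cases "k = 0") auto
    ultimately have "k = 1" by simp
    with k have "card G = card {1..<int p}" by (simp add: D_def)
    with Gc have "G = {1..<int p}" by (intro card_subset_eq) auto
    with proper car show False by simp
  qed
  \<comment> \<open>Lagrange's theorem in \<open>G\<close> itself, regarded as a group of order
    \<open>D\<close>.\<close>
  have pow: "[g ^ D = 1] (mod int p)" if g: "g \<in> G" for g
  proof -
    interpret H: group "(Fp_star p)\<lparr>carrier := G\<rparr>" by (rule subgroup.subgroup_is_group[OF G grp.is_group])
    have "g [^]\<^bsub>(Fp_star p)\<lparr>carrier := G\<rparr>\<^esub> D = \<one>\<^bsub>Fp p\<^esub>"
      using H.pow_order_eq_1[of g] g by (simp add: Coset.order_def D_def)
    then have "g [^]\<^bsub>Fp p\<^esub> D = \<one>\<^bsub>Fp p\<^esub>"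
      by (simp add: nat_pow_def)
    moreover have "g [^]\<^bsub>Fp p\<^esub> D = g ^ D mod int p"
      using pow_cong[of g D] g Gc by (auto simp: mod_pos_pos_trivial)
    ultimately show ?thesis using p2 by (simp add: cong_def residue_ring_def)
  qed
  \<comment> \<open>The polynomial \<open>x ^ D - 1\<close> has at most \<open>D\<close> roots
    modulo \<open>p\<close>, so \<open>G\<close> consists of all of them. Membership in the shifted
    set thus becomes the power congruence used above.\<close>
  have Geq: "G = {g \<in> {1..<int p}. [g ^ D = 1] (mod int p)}"
  proof (rule card_seteq)
    show "G \<subseteq> {g \<in> {1..<int p}. [g ^ D = 1] (mod int p)}" using Gc pow by blast
    show "card {g \<in> {1..<int p}. [g ^ D = 1] (mod int p)} \<le> card G"
      using card_power_eq_one_mod[OF p, of D] D0 unfolding D_def by simp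
  qed (rule finite_subset[of _ "{1..<int p}"], auto)
  have sub: "g \<ominus>\<^bsub>Fp p\<^esub> l = (g - l) mod int p" for g
  proof -
    have "\<ominus>\<^bsub>Fp p\<^esub> l = (- l) mod int p" by (rule res_neg_eq)
    then show ?thesis unfolding a_minus_def by (simp add: residue_ring_def mod_simps)
  qed
  have "l \<in> {1..<int p}" using l car by blast
  then have l0: "\<not> int p dvd l" using zdvd_not_zless by auto
  have z0: "\<zero>\<^bsub>Fp p\<^esub> = 0" by (simp add: residue_ring_def)
  have shift: "shift_set p G l = (\<lambda>g. (g - l) mod int p) ` G" by (auto simp: shift_set_def sub)
  have S: "shift_set p G l - {\<zero>\<^bsub>Fp p\<^esub>} = {s \<in> {1..<int p}. [(s + l) ^ D = 1] (mod int p)}" (is "_ = ?S")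
  proof (intro Set.set_eqI iffI)
    fix s assume "s \<in> shift_set p G l - {\<zero>\<^bsub>Fp p\<^esub>}"
    then obtain g where g: "g \<in> G" "s = (g - l) mod int p" "s \<noteq> 0"
      unfolding shift z0 by blast
    have "[s + l = g - l + l] (mod int p)" unfolding g(2) by (intro cong_add) (simp_all add: cong_def)
    then have "[(s + l) ^ D = g ^ D] (mod int p)" by (intro cong_pow) simp
    with pow[OF g(1)] have "[(s + l) ^ D = 1] (mod int p)" by (metis cong_trans)
    moreover have "0 \<le> s" "s < int p" using g(2) p2 by auto
    ultimately show "s \<in> ?S" using g(3) by auto
  next
    fix s assume s: "s \<in> ?S"
    define g where "g = (s + l) mod int p"
    have cg: "[g = s + l] (mod int p)" by (simp add: g_def cong_def)
    then have gD: "[g ^ D = 1] (mod int p)" using s cong_pow[OF cg, of D] by (auto intro: cong_trans)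
    have "g \<noteq> 0"
    proof
      assume "g = 0"
      moreover have "D > 0" using D0 by simp
      ultimately show False using gD p2 by (simp add: cong_def power_0_left)
    qed
    moreover have "0 \<le> g" "g < int p" using p2 by (auto simp: g_def)
    ultimately have "g \<in> G" using gD by (subst Geq) auto
    moreover have "s = (g - l) mod int p"
    proof -
      have "[g - l = s] (mod int p)" using cong_diff[OF cg cong_refl[of l]] by simp
      then show ?thesis using s by (simp add: cong_def)
    qed
    ultimately show "s \<in> shift_set p G l - {\<zero>\<^bsub>Fp p\<^esub>}"
      unfolding shift z0 using s by auto
  qed
  \<comment> \<open>The shift is injective, and removing zero costs at most one element.\<close>
  have cS: "D \<le> card ?S + 1"
  proof -
    have "inj_on (\<lambda>g. (g - l) mod int p) G"
    proof (rule inj_onI)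
      fix x y assume xy: "x \<in> G" "y \<in> G" "(x - l) mod int p = (y - l) mod int p"
      then have "[x - l + l = y - l + l] (mod int p)" by (intro cong_add) (simp_all add: cong_def)
      then have "x mod int p = y mod int p" by (simp add: cong_def)
      moreover have "0 \<le> x" "x < int p" "0 \<le> y" "y < int p" using xy Gc by auto
      ultimately show "x = y" by simp
    qed
    then have "card (shift_set p G l) = D" unfolding shift by (simp add: card_image D_def)
    moreover have "card (shift_set p G l) - 1 \<le> card (shift_set p G l - {\<zero>\<^bsub>Fp p\<^esub>})"
      using diff_card_le_card_Diff[of "{\<zero>\<^bsub>Fp p\<^esub>}" "shift_set p G l"] by simp
    ultimately show ?thesis unfolding S by simp
  qed
  have "(\<lambda>(a, b, c). a * b * c mod int p) ` (A \<times> B \<times> C) = prod_set3 p A B C"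
  proof -
    have "a \<otimes>\<^bsub>Fp p\<^esub> b \<otimes>\<^bsub>Fp p\<^esub> c = a * b * c mod int p" for a b c
      by (simp add: residue_ring_def mod_mult_left_eq)
    then show ?thesis unfolding prod_set3_def by (auto simp: image_iff) blast
  qed
  with eq S have SS: "(\<lambda>(a, b, c). a * b * c mod int p) ` (A \<times> B \<times> C) = ?S" by simp
  show False
    using no_ternary_product[OF p k k2 D0 l0 _ ABC(4) _ ABC(5) _ ABC(6) SS cS] ABC(1-3) car by simp
qed simp

end
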